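(* Let $n\in\mathbb{N}$, let $(a,b,B)\in\mathbb{R}\times\mathbb{R}\times(0,\infty]$, let $S_1,\dots,S_n$ be Polish spaces, let $Z_{1:n}=(Z_1,\dots,Z_n)$ be a random element of $S_1\times\cdots\times S_n$, and let $\mathcal{G}_{1:n}$ be a set of $n$-tuples $g_{1:n}=(g_1,\dots,g_n)$ of Borel-measurable functions $g_k:S_k\to\mathbb{R}$ such that $$\sup_{g_{1:n}\in\mathcal{G}_{1:n}}\ \sup_{1\le k\le n}\|g_k(Z_k)\|_{\mathbb{P},\infty}\le B .$$ Moreover, assume that there exists a function $L_{a,b}:\{1,\dots,n\}\times[0,\infty]\to[0,\infty)$ such that for any $t\ge 0$, any (nonempty) $J\subset\{1,\dots,n\}$, and some $Z_J^*=(Z_j^* )_{j\in J}$ with independent entries and the same marginals as $Z_J$, we have $$\mathbb{P}\Big(\sup_{g_J\in\mathcal{G}_J}(aA_{Z_J^*}+b\mu_{Z_J})g_J\ge t\Big)\le L_{a,b}(|J|,t).$$ Let $m\in\{1,\dots,n\}$ and write $n=qm+r$ with $q=\lfloor n/m\rfloor$ and $0\le r<m$. Then, for every $t\ge 0$, $$\mathbb{P}\Big(\sup_{g_{1:n}\in\mathcal{G}_{1:n}}(aA_{Z_{1:n}}+b\mu_{Z_{1:n}})g_{1:n}\ge t\Big)\le \big(rL_{a,b}(q+1,t)+(m-r)L_{a,b}(q,t)+n\beta_{Z_{1:n}}(m)\big)\mathbf{1}_{\{t\le(|a|+|b|)B\}}$$ $$\le \big(m\max\{L_{a,b}(q+1,t),L_{a,b}(q,t)\}+n\beta_{Z_{1:n}}(m)\big)\mathbf{1}_{\{t\le(|a|+|b|)B\}},$$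 with the convention $L_{a,b}(n+1,t):=L_{a,b}(n,t)$.
   Context: All random variables live on a probability space $(\Omega,\mathcal{E},\mathbb{P})$, which by convention is rich enough to support all the random variables considered. $\mathbb{N}=\{1,2,\dots\}$. $\|\cdot\|_{\mathbb{P},\infty}$ is the $L^\infty(\mathbb{P})$ norm. For $J\subset\{1,\dots,n\}$ and a tuple $c_{1:n}$, $c_J:=(c_j)_{j\in J}$; $\mathcal{G}_J:=\{g_J: g_{1:n}\in\mathcal{G}_{1:n}\}$ is the projection of $\mathcal{G}_{1:n}$ onto the coordinates in $J$. For a nonempty finite index set $J$, a random element $Z_J=(Z_j)_{j\in J}$ of $\prod_{j\in J}S_j$ and a tuple $g_J=(g_j)_{j\in J}$ of Borel functions $g_j:S_j\to\mathbb{R}$, $$A_{Z_J}g_J:=\frac{1}{|J|}\sum_{j\in J}g_j(Z_j),\qquad \mu_{Z_J}g_J:=\frac{1}{|J|}\sum_{j\in J}\int_{S_j}g_j(z)\,\mathbb{P}_{Z_j}(dz),$$ where $\mathbb{P}_{Z_j}$ is the law of $Z_j$ (the second average is considered only where it makes sense), and $(aA_{Z_J}+b\mu_{Z_J})g_J:=aA_{Z_J}g_J+b\mu_{Z_J}g_J$; similarly with $Z_J^*$ in place of $Z_J$ in the empirical mean. $\beta$-mixing coefficients: for sub-sigma-algebras $\mathcal{E}_1,\mathcal{E}_2$ of $\mathcal{E}$, $$\beta(\mathcal{E}_1,\mathcal{E}_2):=\mathbb{E}\Big[\operatorname{ess\,sup}_{E_1\in\mathcal{E}_1}|\mathbb{P}(E_1)-\mathbb{P}[E_1|\mathcal{E}_2]|\Big],$$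 where $\operatorname{ess\,sup}$ denotes the essential supremum of a family of random variables. For $J\subset\mathbb{N}$, a random sequence $Z_J$, and $(m,l)\in\mathbb{N}\times\mathbb{N}$, $$\beta_{Z_J}(m,l):=\beta\big(\sigma(Z_{J\cap[1,l-m]}),\sigma(Z_{J\cap\{l\}})\big),\qquad \beta_{Z_J}(m):=\sup_{l\in\mathbb{N}}\beta_{Z_J}(m,l),$$ with the convention that $Z_\emptyset:=\emptyset$ (so $\sigma(Z_\emptyset)$ is trivial). $\beta_{Z_{1:n}}(m)$ is the case $J=\{1,\dots,n\}$.
   Formalization: Added: for each nonempty J the supremum over G_J is a Borel function on the product of the S_j; and, if B is finite, the supremum over G_{1:n} a.s. equals that over a countable subfamily. Without these the claim fails, e.g. for indicators of singletons. *)

theory Defs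
  imports "HOL-Probability.Probability"
begin

text \<open>
  Polish spaces are topologies whose carriers \<^term>\<open>topspace X\<close> may be different subsets of one
  common type, so that a finite family of unrelated Polish spaces can be treated.
\<close>

definition Polish_space :: "'a topology \<Rightarrow> bool" where
  "Polish_space X \<longleftrightarrow> completely_metrizable_space X \<and> separable_space X"

definition borel_of :: "'a topology \<Rightarrow> 'a measure" where
  "borel_of X = sigma (topspace X) {U. openin X U}"

text \<open>
  A tuple \<open>g\<^sub>J\<close> is a function that is constantly \<^term>\<open>undefined\<close> outside \<open>J\<close>.
\<close>

definition coord_proj :: "nat set \<Rightarrow> (nat \<Rightarrow> 'b) set \<Rightarrow> (nat \<Rightarrow> 'b) set" where
  "coord_proj J G = (\<lambda>g. restrict g J) ` G"

definition emp_mean :: "nat set \<Rightarrow> (nat \<Rightarrow> 'w \<Rightarrow> 'a) \<Rightarrow> (nat \<Rightarrow> 'a \<Rightarrow> real) \<Rightarrow> 'w \<Rightarrow> real" where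
  "emp_mean J Z g \<omega> = (\<Sum>j\<in>J. g j (Z j \<omega>)) / real (card J)"

text \<open>
  The Bochner integral of a non-integrable function is \<open>0\<close>; apart from this totalisation,
  \<open>pop_mean\<close> is the average of the expectations of \<open>g\<^sub>j(Z\<^sub>j)\<close>, computed under the laws of the \<open>Z\<^sub>j\<close>.
\<close>

definition pop_mean ::
  "'w measure \<Rightarrow> (nat \<Rightarrow> 'a topology) \<Rightarrow> nat set \<Rightarrow> (nat \<Rightarrow> 'w \<Rightarrow> 'a) \<Rightarrow> (nat \<Rightarrow> 'a \<Rightarrow> real) \<Rightarrow> real" where
  "pop_mean M S J Z g =
     (\<Sum>j\<in>J. \<integral>z. g j z \<partial>(distr M (borel_of (S j)) (Z j))) / real (card J)"

text \<open>
  Essential supremum of a (possibly uncountable) family of random variables: the almost surely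
  unique least random variable that dominates each member of the family almost surely. The library
  constant \<^const>\<open>esssup\<close> is the different notion for a single function, used for the
  \<open>L\<^sup>\<infinity>\<close> norm.
\<close>

definition is_esssup_family ::
  "'w measure \<Rightarrow> 'i set \<Rightarrow> ('i \<Rightarrow> 'w \<Rightarrow> ereal) \<Rightarrow> ('w \<Rightarrow> ereal) \<Rightarrow> bool" where
  "is_esssup_family M I X Y \<longleftrightarrow>
     Y \<in> borel_measurable M \<and>
     (\<forall>i\<in>I. AE \<omega> in M. X i \<omega> \<le> Y \<omega>) \<and>
     (\<forall>Y'\<in>borel_measurable M. (\<forall>i\<in>I. AE \<omega> in M. X i \<omega> \<le> Y' \<omega>) \<longrightarrow> (AE \<omega> in M. Y \<omega> \<le> Y' \<omega>))"

definition esssup_family :: "'w measure \<Rightarrow> 'i set \<Rightarrow> ('i \<Rightarrow> 'w \<Rightarrow> ereal) \<Rightarrow> 'w \<Rightarrow> ereal" where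
  "esssup_family M I X = (SOME Y. is_esssup_family M I X Y)"

text \<open>
  Following \<^const>\<open>real_cond_exp\<close>, a sub-sigma-algebra is given as a measure of which only the
  sigma-algebra matters.
\<close>

definition beta_dep :: "'w measure \<Rightarrow> 'w measure \<Rightarrow> 'w measure \<Rightarrow> ennreal" where
  "beta_dep M F1 F2 =
     (\<integral>\<^sup>+ \<omega>. e2ennreal (esssup_family M (sets F1)
        (\<lambda>E \<omega>'. ereal \<bar>measure M E - real_cond_exp M F2 (indicator E) \<omega>'\<bar>) \<omega>) \<partial>M)"

text \<open>
  The sigma-algebra generated by \<open>Z\<^sub>K\<close>. For \<open>K = {}\<close> the product space is a singleton, so the
  generated sigma-algebra is trivial.
\<close>

definition gen_sigma ::
  "'w measure \<Rightarrow> (nat \<Rightarrow> 'a topology) \<Rightarrow> (nat \<Rightarrow> 'w \<Rightarrow> 'a) \<Rightarrow> nat set \<Rightarrow> 'w measure" where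
  "gen_sigma M S Z K =
     vimage_algebra (space M) (\<lambda>\<omega>. \<lambda>k\<in>K. Z k \<omega>) (Pi\<^sub>M K (\<lambda>k. borel_of (S k)))"

text \<open>For \<open>l \<le> m\<close> the truncated difference gives \<open>{1..l - m} = {}\<close>, as intended.\<close>

definition beta_coeff_at ::
  "'w measure \<Rightarrow> (nat \<Rightarrow> 'a topology) \<Rightarrow> nat set \<Rightarrow> (nat \<Rightarrow> 'w \<Rightarrow> 'a) \<Rightarrow> nat \<Rightarrow> nat \<Rightarrow> ennreal" where
  "beta_coeff_at M S J Z m l =
     beta_dep M (gen_sigma M S Z (J \<inter> {1..l - m})) (gen_sigma M S Z (J \<inter> {l}))"

definition beta_coeff ::
  "'w measure \<Rightarrow> (nat \<Rightarrow> 'a topology) \<Rightarrow> nat set \<Rightarrow> (nat \<Rightarrow> 'w \<Rightarrow> 'a) \<Rightarrow> nat \<Rightarrow> ennreal" where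
  "beta_coeff M S J Z m = (SUP l\<in>{1..}. beta_coeff_at M S J Z m l)"

text \<open>
  Conventions that make the probability of \<open>sup \<ge> t\<close> over an uncountable class meaningful.
  \<open>measurable_sup\<close>: the supremum over \<open>G\<^sub>J\<close> is a Borel function of the point \<open>z\<close> of the product of the
  \<open>S\<^sub>j\<close>, so that the event is measurable and its probability depends only on the law of the
  sample plugged in.
  \<open>separable_sup\<close>: almost surely, the supremum over \<open>G\<close> equals that over a countable subfamily. It
  is what allows \<open>L\<^sup>\<infinity>\<close> bounds, one for each \<open>g\<close>, to bound the supremum over \<open>g\<close>: with \<open>Z\<close> uniform
  on \<open>[0,1]\<close> and \<open>G\<close> the indicators of the singletons, every \<open>g(Z)\<close> has norm \<open>0\<close> while the
  supremum is identically \<open>1\<close>. Both hold if \<open>G\<close> is countable.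
\<close>

definition measurable_sup ::
  "'w measure \<Rightarrow> (nat \<Rightarrow> 'a topology) \<Rightarrow> (nat \<Rightarrow> 'w \<Rightarrow> 'a) \<Rightarrow> (nat \<Rightarrow> 'a \<Rightarrow> real) set \<Rightarrow>
   real \<Rightarrow> real \<Rightarrow> nat set \<Rightarrow> bool" where
  "measurable_sup M S Z G a b J \<longleftrightarrow>
     (\<lambda>z. SUP g\<in>coord_proj J G. ereal (a * emp_mean J (\<lambda>j z. z j) g z + b * pop_mean M S J Z g))
       \<in> borel_measurable (Pi\<^sub>M J (\<lambda>j. borel_of (S j)))"

definition separable_sup ::
  "'w measure \<Rightarrow> (nat \<Rightarrow> 'a topology) \<Rightarrow> (nat \<Rightarrow> 'w \<Rightarrow> 'a) \<Rightarrow> (nat \<Rightarrow> 'a \<Rightarrow> real) set \<Rightarrow>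
   real \<Rightarrow> real \<Rightarrow> nat set \<Rightarrow> bool" where
  "separable_sup M S Z G a b J \<longleftrightarrow>
     (\<exists>G0\<subseteq>G. countable G0 \<and>
        (AE \<omega> in M. (SUP g\<in>G. ereal (a * emp_mean J Z g \<omega> + b * pop_mean M S J Z g))
                  = (SUP g\<in>G0. ereal (a * emp_mean J Z g \<omega> + b * pop_mean M S J Z g))))"

end

theory Submission
  imports Defs
begin

text \<open>
  Split \<open>{1..n}\<close> into the \<open>m\<close> residue classes modulo \<open>m\<close>; \<open>r\<close> of them have \<open>q + 1\<close> elements and the
  others \<open>q\<close>. The average over \<open>{1..n}\<close> is a convex combination of the averages over the classes, so if
  its supremum reaches \<open>t\<close>, then so does the supremum over some class. Inside a class \<open>J\<close> consecutive
  indices are \<open>m\<close> apart: peeling off the largest index, one at a time, replaces the law of \<open>Z\<^sub>J\<close> by the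
  product of its marginals at the cost of one \<open>\<beta>(m)\<close> per index. Summed over all classes, this costs at
  most \<open>n \<beta>(m)\<close>.
\<close>

section \<open>Essential suprema and approximation by an algebra\<close>

text \<open>The coefficient is asymmetric: events from the past are conditioned on the single
  variable \<open>Z l\<close>. This dictates how two laws are compared. A set is sliced by the value
  of \<open>Z l\<close>, every slice is an event about the past, and the slices are compared before
  integrating. As the essential supremum over past events stands inside the expectation, slices that
  vary with \<open>Z l\<close> cost no more than one fixed event: a single \<open>beta_dep\<close>
  pays for all of them. No coupling of the dependent sample with an independent one is built. Only
  an upper bound for the probability of one event is wanted, and only the law of the independent
  sample enters, so that sample may live on another probability space. The truncation in
  \<open>t\<close> is a separate matter: beyond \<open>(|a| + |b|) B\<close> the event is null. For
  finite \<open>B\<close> this rests on replacing the supremum by one over a countable subfamily,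
  because the norm bounds come with one null set per function.\<close>

lemma ex_is_esssup_family:
  fixes X :: "'i \<Rightarrow> 'w \<Rightarrow> ereal" and c :: real
  assumes M: "finite_measure M" and I: "I \<noteq> {}"
    and X[measurable]: "\<And>i. i \<in> I \<Longrightarrow> X i \<in> borel_measurable M"
    and bd: "\<And>i. i \<in> I \<Longrightarrow> AE \<omega> in M. 0 \<le> X i \<omega> \<and> X i \<omega> \<le> ereal c"
  shows "\<exists>Y. is_esssup_family M I X Y"
proof -
  interpret finite_measure M by fact
  \<comment> \<open>Exhaustion argument: among the countable subfamilies one is sought that
    maximises the integral of the pointwise supremum. Its supremum must dominate every member almost
    surely, since otherwise adding that member would increase the integral.\<close>
  define \<Phi> where "\<Phi> C = (\<integral>\<^sup>+\<omega>. e2ennreal (SUP i\<in>C. X i \<omega>) \<partial>M)" for C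
  define \<C> where "\<C> = {C. C \<subseteq> I \<and> countable C}"
  have meas: "(\<lambda>\<omega>. SUP i\<in>C. X i \<omega>) \<in> borel_measurable M" if "C \<in> \<C>" for C
    using that by (intro borel_measurable_SUP X) (auto simp: \<C>_def)
  have "{} \<in> \<C>"
    by (auto simp: \<C>_def)
  then obtain f where f: "range f \<subseteq> \<Phi> ` \<C>" "(SUP C\<in>\<C>. \<Phi> C) = (SUP k::nat. f k)"
    using ennreal_Sup_countable_SUP[of "\<Phi> ` \<C>"] by auto
  obtain i0 where i0: "i0 \<in> I"
    using I by blast
  have "\<forall>k. \<exists>C\<in>\<C>. f k = \<Phi> C"
    using f(1) by auto
  then obtain C where C: "\<And>k. C k \<in> \<C>" "\<And>k. f k = \<Phi> (C k)"
    by metis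
  \<comment> \<open>A union of a maximising sequence of countable families attains the maximum. The
    extra \<open>i0\<close> keeps \<open>D\<close> nonempty: the supremum over the empty set is
    minus infinity, whereas \<open>Y\<close> has to be nonnegative almost surely.\<close>
  define D where "D = insert i0 (\<Union>k. C k)"
  define Y where "Y \<omega> = (SUP i\<in>D. X i \<omega>)" for \<omega>
  have D: "D \<in> \<C>" "countable D"
    using C(1) i0 by (auto simp: D_def \<C>_def)
  have Y[measurable]: "Y \<in> borel_measurable M"
    unfolding Y_def by (rule meas) fact
  have mono: "\<Phi> A \<le> \<Phi> A'" if "A \<subseteq> A'" for A A'
    unfolding \<Phi>_def using that by (intro nn_integral_mono e2ennreal_mono SUP_subset_mono) auto
  have max: "\<Phi> A \<le> \<Phi> D" if "A \<in> \<C>" for A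
  proof -
    have "\<Phi> A \<le> (SUP k. f k)"
      unfolding f(2)[symmetric] using that by (rule SUP_upper)
    also have "\<dots> \<le> \<Phi> D"
      unfolding C(2) by (intro SUP_least mono) (auto simp: D_def)
    finally show ?thesis .
  qed
  have "AE \<omega> in M. \<forall>i\<in>D. 0 \<le> X i \<omega> \<and> X i \<omega> \<le> ereal c"
    using D bd by (subst AE_ball_countable) (auto simp: \<C>_def)
  then have Ybd: "AE \<omega> in M. 0 \<le> Y \<omega> \<and> Y \<omega> \<le> ereal c"
    proof eventually_elim
    case (elim \<omega>)
    have "i0 \<in> D"
      by (simp add: D_def)
    with elim show ?case
      unfolding Y_def by (auto intro!: SUP_least intro: SUP_upper2[of i0])
  qed
  have fin: "\<Phi> D \<noteq> \<infinity>"
  proof -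
    have "AE \<omega> in M. e2ennreal (Y \<omega>) \<le> ennreal c"
      using Ybd
    proof eventually_elim
      case (elim \<omega>)
      then show ?case
        using e2ennreal_mono[of "Y \<omega>" "ereal c"] by (simp add: e2ennreal_ereal)
    qed
    then have "\<Phi> D \<le> (\<integral>\<^sup>+\<omega>. ennreal c \<partial>M)"
      unfolding \<Phi>_def Y_def[symmetric] by (rule nn_integral_mono_AE)
    also have "\<dots> < \<infinity>"
      by (simp add: emeasure_eq_measure ennreal_mult_less_top)
    finally show ?thesis
      by simp
  qed
  have dom: "AE \<omega> in M. X i \<omega> \<le> Y \<omega>" if i: "i \<in> I" for i
  proof -
    define Y' where "Y' \<omega> = (SUP j\<in>insert i D. X j \<omega>)" for \<omega>
    have iD: "insert i D \<in> \<C>"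
      using D i by (auto simp: \<C>_def)
    have [measurable]: "Y' \<in> borel_measurable M"
      unfolding Y'_def by (rule meas) fact
    have le: "Y \<omega> \<le> Y' \<omega>" for \<omega>
      unfolding Y_def Y'_def by (rule SUP_subset_mono) auto
    \<comment> \<open>Maximality and finiteness of the integral over \<open>D\<close> leave no room
      for a gain, so the gain is zero almost everywhere. Nonnegativity of \<open>X i\<close> and
      \<open>Y\<close> then lets the comparison be carried back from \<open>ennreal\<close> to
      \<open>ereal\<close>, where \<open>e2ennreal\<close> would have cut off negative
      values.\<close>
    have "(\<integral>\<^sup>+\<omega>. e2ennreal (Y' \<omega>) - e2ennreal (Y \<omega>) \<partial>M) = \<Phi> (insert i D) - \<Phi> D"
      unfolding \<Phi>_def Y_def[symmetric] Y'_def[symmetric]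
    proof (rule nn_integral_diff)
      show "(\<integral>\<^sup>+\<omega>. e2ennreal (Y \<omega>) \<partial>M) \<noteq> \<infinity>"
        using fin by (simp add: \<Phi>_def Y_def)
      show "AE \<omega> in M. e2ennreal (Y \<omega>) \<le> e2ennreal (Y' \<omega>)"
        by (intro AE_I2 e2ennreal_mono le)
    qed measurable
    also have "\<dots> = 0"
      using max[OF iD] fin by (simp add: diff_eq_0_iff_ennreal less_top)
    finally have "AE \<omega> in M. e2ennreal (Y' \<omega>) - e2ennreal (Y \<omega>) = 0"
      by (subst (asm) nn_integral_0_iff_AE) auto
    with Ybd bd[OF i] show ?thesis
    proof eventually_elim
      case (elim \<omega>)
      have "e2ennreal (X i \<omega>) \<le> e2ennreal (Y' \<omega>)"
        unfolding Y'_def by (intro e2ennreal_mono SUP_upper) auto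
      also have "\<dots> \<le> e2ennreal (Y \<omega>)"
        using elim by (auto simp: diff_eq_0_iff_ennreal)
      finally show ?case
        using elim by (metis enn2ereal_e2ennreal less_eq_ennreal.rep_eq)
    qed
  qed
  have least: "AE \<omega> in M. Y \<omega> \<le> Y' \<omega>" if "\<forall>i\<in>I. AE \<omega> in M. X i \<omega> \<le> Y' \<omega>" for Y'
  proof -
    have "AE \<omega> in M. \<forall>i\<in>D. X i \<omega> \<le> Y' \<omega>"
      using D that by (subst AE_ball_countable) (auto simp: \<C>_def)
    then show ?thesis
      by eventually_elim (auto simp: Y_def intro: SUP_least)
  qed
  show ?thesis
    unfolding is_esssup_family_def using dom least by (intro exI[of _ Y]) auto
qed

text \<open>The induction on how \<open>A\<close> is generated carries the sum of the two measures,
  so that one and the same \<open>B\<close> is close to \<open>A\<close> under both. Two separate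
  approximations would not allow a comparison of \<open>\<mu>\<close> and \<open>\<nu>\<close> on
  \<open>B\<close> to be passed on to \<open>A\<close>.\<close>

lemma sigma_sets_approx_algebra:
  assumes \<mu>: "finite_measure \<mu>" and \<nu>: "finite_measure \<nu>"
    and sets: "sets \<mu> = sigma_sets \<Omega> \<A>" "sets \<nu> = sigma_sets \<Omega> \<A>"
    and alg: "algebra \<Omega> \<A>"
    and A: "A \<in> sigma_sets \<Omega> \<A>" and e: "0 < e"
  shows "\<exists>B\<in>\<A>. measure \<mu> (sym_diff A B) + measure \<nu> (sym_diff A B) < e"
  using A e
proof (induction arbitrary: e)
  case (Basic a)
  then show ?case
    by (intro bexI[of _ a]) auto
next
  case Empty
  interpret algebra \<Omega> \<A> by fact
  from Empty show ?case
    by (intro bexI[of _ "{}"]) auto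
next
  case (Compl a)
  interpret algebra \<Omega> \<A> by fact
  obtain B where B: "B \<in> \<A>" "measure \<mu> (sym_diff a B) + measure \<nu> (sym_diff a B) < e"
    using Compl by blast
  have "a \<subseteq> \<Omega>" "B \<subseteq> \<Omega>"
    using Compl.hyps B(1) sigma_sets_into_sp[OF space_closed] by (auto dest: sets_into_space)
  then have "sym_diff (\<Omega> - a) (\<Omega> - B) = sym_diff a B"
    by auto
  with B show ?case
    by (intro bexI[of _ "\<Omega> - B"]) auto
next
  case (Union a)
  interpret algebra \<Omega> \<A> by fact
  interpret \<mu>: finite_measure \<mu> by fact
  interpret \<nu>: finite_measure \<nu> by fact
  let ?m = "\<lambda>A. measure \<mu> A + measure \<nu> A"
  let ?U = "\<lambda>k. \<Union>i<k. a i"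
  have a: "a i \<in> sets \<mu>" "a i \<in> sets \<nu>" for i
    using Union.hyps by (auto simp: sets)
  have Us: "(\<Union>i. a i) \<in> sets \<mu>" "(\<Union>i. a i) \<in> sets \<nu>" "?U k \<in> sets \<mu>" "?U k \<in> sets \<nu>" for k
    using a by auto
  have inc: "incseq ?U"
    by (force simp: incseq_def)
  have UU: "(\<Union>k. ?U k) = (\<Union>i. a i)"
    by auto
  have "(\<lambda>k. ?m (?U k)) \<longlonglongrightarrow> ?m (\<Union>i. a i)"
    using \<mu>.finite_Lim_measure_incseq[OF _ inc] \<nu>.finite_Lim_measure_incseq[OF _ inc] Us
    unfolding UU by (intro tendsto_add) auto
  then have "\<forall>\<^sub>F k in sequentially. ?m (?U k) > ?m (\<Union>i. a i) - e / 2"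
    using Union.prems by (intro order_tendstoD) auto
  then obtain k where k: "?m (?U k) > ?m (\<Union>i. a i) - e / 2"
    by (auto simp: eventually_sequentially)
  \<comment> \<open>Half of \<open>e\<close> was spent on cutting the union after \<open>k\<close>
    sets; the other half is shared among these. The denominator has \<open>k + 1\<close> in place of
    \<open>k\<close> so that it is nonzero for \<open>k = 0\<close>.\<close>
  have "\<forall>i. \<exists>B\<in>\<A>. ?m (sym_diff (a i) B) < e / (2 * (real k + 1))"
    using Union.IH[of "e / (2 * (real k + 1))"] Union.prems by auto
  then obtain B where B: "\<And>i. B i \<in> \<A>" "\<And>i. ?m (sym_diff (a i) (B i)) < e / (2 * (real k + 1))"
    by metis
  have Bs: "B i \<in> sets \<mu>" "B i \<in> sets \<nu>" for i
    using B(1) by (auto simp: sets)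
  define V where "V = (\<Union>i<k. B i)"
  have V: "V \<in> \<A>"
    unfolding V_def using B(1) by auto
  let ?D = "\<Union>i<k. sym_diff (a i) (B i)"
  have sub: "sym_diff (\<Union>i. a i) V \<subseteq> ((\<Union>i. a i) - ?U k) \<union> ?D"
    unfolding V_def by auto
  have Ds: "?D \<in> sets \<mu>" "?D \<in> sets \<nu>"
    using a Bs by auto
  have "?m (sym_diff (\<Union>i. a i) V) \<le> ?m (((\<Union>i. a i) - ?U k) \<union> ?D)"
    using Us Ds sub by (intro add_mono \<mu>.finite_measure_mono \<nu>.finite_measure_mono) auto
  also have "\<dots> \<le> ?m ((\<Union>i. a i) - ?U k) + ?m ?D"
    using measure_Un_le[of "(\<Union>i. a i) - ?U k" \<mu> ?D]
      measure_Un_le[of "(\<Union>i. a i) - ?U k" \<nu> ?D] Us Ds by auto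
  also have "?m ((\<Union>i. a i) - ?U k) = ?m (\<Union>i. a i) - ?m (?U k)"
  proof -
    have "?U k \<subseteq> (\<Union>i. a i)"
      by auto
    with Us show ?thesis
      by (simp add: \<mu>.finite_measure_Diff \<nu>.finite_measure_Diff)
  qed
  also have "?m ?D \<le> (\<Sum>i<k. ?m (sym_diff (a i) (B i)))"
    unfolding sum.distrib using a Bs
    by (intro add_mono \<mu>.finite_measure_subadditive_finite \<nu>.finite_measure_subadditive_finite) auto
  also have "\<dots> \<le> (\<Sum>i<k. e / (2 * (real k + 1)))"
    using B(2) by (intro sum_mono less_imp_le)
  also have "\<dots> \<le> e / 2"
    using Union.prems by (simp add: field_simps)
  finally have "?m (sym_diff (\<Union>i. a i) V) < e"
    using k by linarith
  with V show ?case
    by blast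
qed

section \<open>Comparing a joint law with the product of its marginals\<close>

text \<open>
  Sets whose section over \<open>y\<close> depends on \<open>y\<close> only through a discrete variable \<open>\<phi> y\<close>. For them the
  \<open>\<beta>\<close>-coefficient bounds the difference of the two laws directly, without regular conditional
  distributions; since they form a generating algebra, the bound extends to all measurable sets.
\<close>

definition countable_section_sets :: "'a measure \<Rightarrow> 'b measure \<Rightarrow> ('a \<times> 'b) set set" where
  "countable_section_sets A B =
     {{p \<in> space A \<times> space B. fst p \<in> E (\<phi> (snd p))} | (E :: nat \<Rightarrow> 'a set) \<phi>.
        range E \<subseteq> sets A \<and> \<phi> \<in> measurable B (count_space UNIV)}"

lemma countable_section_setsI:
  assumes "\<And>i :: nat. E i \<in> sets A" "\<phi> \<in> measurable B (count_space UNIV)"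
    and "C = {p \<in> space A \<times> space B. fst p \<in> E (\<phi> (snd p))}"
  shows "C \<in> countable_section_sets A B"
  unfolding countable_section_sets_def
  using assms by (intro CollectI exI[of _ E] exI[of _ \<phi>] conjI) auto

lemma countable_section_setsE:
  assumes "C \<in> countable_section_sets A B"
  obtains E :: "nat \<Rightarrow> 'a set" and \<phi> where "\<And>i. E i \<in> sets A" "\<phi> \<in> measurable B (count_space UNIV)"
    and "C = {p \<in> space A \<times> space B. fst p \<in> E (\<phi> (snd p))}"
proof -
  obtain E :: "nat \<Rightarrow> 'a set" and \<phi> where "range E \<subseteq> sets A" "\<phi> \<in> measurable B (count_space UNIV)"
    and "C = {p \<in> space A \<times> space B. fst p \<in> E (\<phi> (snd p))}"
    using assms unfolding countable_section_sets_def by (elim CollectE exE conjE)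
  then show thesis
    by (intro that[of E \<phi>]) auto
qed

lemma countable_section_sets_eq_UN:
  assumes "\<And>i :: nat. E i \<in> sets A"
  shows "{p \<in> space A \<times> space B. fst p \<in> E (\<phi> (snd p))} = (\<Union>i. E i \<times> (\<phi> -` {i} \<inter> space B))"
  using sets.sets_into_space[OF assms] by auto

lemma algebra_countable_section_sets:
  "algebra (space A \<times> space B) (countable_section_sets A B)"
  unfolding algebra_iff_Un
proof (intro conjI ballI)
  show "countable_section_sets A B \<subseteq> Pow (space A \<times> space B)"
    by (auto simp: countable_section_sets_def)
  show "{} \<in> countable_section_sets A B"
    by (rule countable_section_setsI[of "\<lambda>_. {}" _ "\<lambda>_. 0"]) auto
next
  fix C assume "C \<in> countable_section_sets A B"
  then obtain E :: "nat \<Rightarrow> _" and \<phi> where E: "\<And>i. E i \<in> sets A" "\<phi> \<in> measurable B (count_space UNIV)"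
    and C: "C = {p \<in> space A \<times> space B. fst p \<in> E (\<phi> (snd p))}"
    by (rule countable_section_setsE) blast
  show "space A \<times> space B - C \<in> countable_section_sets A B"
    by (rule countable_section_setsI[of "\<lambda>i. space A - E i" _ \<phi>]) (use E C in auto)
next
  fix C C' assume "C \<in> countable_section_sets A B" "C' \<in> countable_section_sets A B"
  obtain E :: "nat \<Rightarrow> _" and \<phi> where E: "\<And>i. E i \<in> sets A"
    and \<phi>: "\<phi> \<in> measurable B (count_space UNIV)"
    and C: "C = {p \<in> space A \<times> space B. fst p \<in> E (\<phi> (snd p))}"
    using \<open>C \<in> countable_section_sets A B\<close> by (rule countable_section_setsE) blast
  obtain E' :: "nat \<Rightarrow> _" and \<phi>' where E': "\<And>i. E' i \<in> sets A"
    and \<phi>': "\<phi>' \<in> measurable B (count_space UNIV)"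
    and C': "C' = {p \<in> space A \<times> space B. fst p \<in> E' (\<phi>' (snd p))}"
    using \<open>C' \<in> countable_section_sets A B\<close> by (rule countable_section_setsE) blast
  \<comment> \<open>The union needs one discrete label that determines both sections.
    \<open>prod_encode\<close> merges the two labels into one natural number, from which
    \<open>prod_decode\<close> recovers the pair of sections to be united.\<close>
  have "(\<lambda>y. prod_encode (i, \<phi>' y)) \<in> measurable B (count_space UNIV)" for i
    by (rule measurable_compose[OF \<phi>']) simp
  then have "(\<lambda>y. prod_encode (\<phi> y, \<phi>' y)) \<in> measurable B (count_space UNIV)"
    using \<phi> by (rule measurable_compose_countable)
  then show "C \<union> C' \<in> countable_section_sets A B"
    by (rule countable_section_setsI[where
            E = "\<lambda>k. E (fst (prod_decode k)) \<union> E' (snd (prod_decode k))", rotated]) (use E E' C C' in auto)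
qed

lemma sigma_sets_countable_section_sets:
  "sigma_sets (space A \<times> space B) (countable_section_sets A B) = sets (A \<Otimes>\<^sub>M B)"
  unfolding sets_pair_measure
proof (rule sigma_sets_eqI)
  fix C assume "C \<in> countable_section_sets A B"
  then obtain E :: "nat \<Rightarrow> _" and \<phi> where E: "\<And>i. E i \<in> sets A"
    and [measurable]: "\<phi> \<in> measurable B (count_space UNIV)"
    and C: "C = {p \<in> space A \<times> space B. fst p \<in> E (\<phi> (snd p))}"
    by (rule countable_section_setsE) blast
  have "C \<in> sets (A \<Otimes>\<^sub>M B)"
    unfolding C countable_section_sets_eq_UN[OF E] using E by measurable
  then show "C \<in> sigma_sets (space A \<times> space B) {a \<times> b |a b. a \<in> sets A \<and> b \<in> sets B}"
    by (simp add: sets_pair_measure)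
next
  fix C assume "C \<in> {a \<times> b |a b. a \<in> sets A \<and> b \<in> sets B}"
  then obtain a b where C: "C = a \<times> b" and [measurable]: "a \<in> sets A" "b \<in> sets B"
    by blast
  \<comment> \<open>A rectangle needs two labels only: 0 on \<open>b\<close>, with section
    \<open>a\<close>, and 1 off \<open>b\<close>, with the empty section.\<close>
  have "C \<in> countable_section_sets A B"
  proof (rule countable_section_setsI)
    show "(\<lambda>y. if y \<in> b then 0 else 1 :: nat) \<in> measurable B (count_space UNIV)"
      by measurable
    show "(if i = 0 then a else {}) \<in> sets A" for i :: nat
      by simp
    show "C = {p \<in> space A \<times> space B.
        fst p \<in> (if (if snd p \<in> b then 0 else 1 :: nat) = 0 then a else {})}"
      using sets.sets_into_space[of a A] sets.sets_into_space[of b B] by (auto simp: C)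
  qed
  then show "C \<in> sigma_sets (space A \<times> space B) (countable_section_sets A B)"
    by blast
qed

text \<open>\<open>esssup_family\<close> is a \<open>SOME\<close> choice, so nothing is known about
  it before existence is shown. The existence lemma applies because conditional expectations of
  indicators lie between 0 and 1 almost surely. The exceptional null set may depend on
  \<open>E\<close>.\<close>

lemma beta_dep_dominating:
  assumes M: "prob_space M" and F1: "subalgebra M F1" and F2: "subalgebra M F2"
  obtains Y where "Y \<in> borel_measurable M" "beta_dep M F1 F2 = (\<integral>\<^sup>+\<omega>. e2ennreal (Y \<omega>) \<partial>M)"
    "\<And>E. E \<in> sets F1 \<Longrightarrow>
       AE \<omega> in M. ereal \<bar>measure M E - real_cond_exp M F2 (indicator E) \<omega>\<bar> \<le> Y \<omega>"
proof -
  interpret prob_space M by fact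
  interpret F2: finite_measure_subalgebra M F2
    by unfold_locales fact
  let ?X = "\<lambda>E \<omega>. ereal \<bar>measure M E - real_cond_exp M F2 (indicator E) \<omega>\<bar>"
  have "\<exists>Y. is_esssup_family M (sets F1) ?X Y"
  proof (rule ex_is_esssup_family)
    show "finite_measure M"
      by unfold_locales
    show "sets F1 \<noteq> {}"
      by auto
  next
    fix E assume "E \<in> sets F1"
    with F1 have [measurable]: "E \<in> sets M"
      by (auto simp: subalgebra_def)
    show "?X E \<in> borel_measurable M"
      by measurable
    have int: "integrable M (indicator E :: _ \<Rightarrow> real)"
      by (intro integrable_real_indicator) (simp_all add: emeasure_eq_measure)
    show "AE \<omega> in M. 0 \<le> ?X E \<omega> \<and> ?X E \<omega> \<le> ereal 1"
    proof -
      have "AE \<omega> in M. 0 \<le> real_cond_exp M F2 (indicator E) \<omega>"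
        by (rule F2.real_cond_exp_ge_c[OF int]) simp
      moreover have "AE \<omega> in M. real_cond_exp M F2 (indicator E) \<omega> \<le> 1"
        by (rule F2.real_cond_exp_le_c[OF int]) (simp add: indicator_def)
      ultimately show ?thesis
      proof eventually_elim
        case (elim \<omega>)
        then have "\<bar>measure M E - real_cond_exp M F2 (indicator E) \<omega>\<bar> \<le> 1"
          using prob_le_1[of E] measure_nonneg[of M E] by linarith
        then show ?case
          by simp
      qed
    qed
  qed
  then have "is_esssup_family M (sets F1) ?X (esssup_family M (sets F1) ?X)"
    unfolding esssup_family_def by (rule someI_ex)
  then show thesis
    by (intro that[of "esssup_family M (sets F1) ?X"]) (auto simp: is_esssup_family_def beta_dep_def)
qed

text \<open>On the event that \<open>\<phi>\<close> equals \<open>i\<close>, which lies in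
  \<open>F2\<close>, the indicator of \<open>E i\<close> may be replaced by its conditional
  expectation, which is at most the probability of \<open>E i\<close> plus the dominating variable
  \<open>Y\<close>. The events for different \<open>i\<close> are disjoint, so the integrals of
  \<open>Y\<close> over them add up to at most one \<open>beta_dep\<close>, however many values
  \<open>\<phi>\<close> takes.\<close>

lemma emeasure_random_section_le:
  fixes E :: "nat \<Rightarrow> 'w set"
  assumes M: "prob_space M" and F1: "subalgebra M F1" and F2: "subalgebra M F2"
    and E: "\<And>i. E i \<in> sets F1" and \<phi>: "\<phi> \<in> measurable F2 (count_space UNIV)"
  shows "emeasure M {\<omega> \<in> space M. \<omega> \<in> E (\<phi> \<omega>)} \<le>
    (\<Sum>i. emeasure M (E i) * emeasure M (\<phi> -` {i} \<inter> space M)) + beta_dep M F1 F2"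
proof -
  interpret prob_space M by fact
  interpret F2: finite_measure_subalgebra M F2
    by unfold_locales fact
  obtain Y where Y[measurable]: "Y \<in> borel_measurable M"
    and beta: "beta_dep M F1 F2 = (\<integral>\<^sup>+\<omega>. e2ennreal (Y \<omega>) \<partial>M)"
    and dom: "\<And>E. E \<in> sets F1 \<Longrightarrow>
       AE \<omega> in M. ereal \<bar>measure M E - real_cond_exp M F2 (indicator E) \<omega>\<bar> \<le> Y \<omega>"
    using beta_dep_dominating[OF M F1 F2] by metis
  have [measurable]: "E i \<in> sets M" for i
    using E F1 by (auto simp: subalgebra_def)
  define P where "P i = \<phi> -` {i} \<inter> space M" for i
  have P2: "P i \<in> sets F2" for i
    using measurable_sets[OF \<phi>, of "{i}"] F2 by (simp add: P_def subalgebra_def)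
  have [measurable]: "P i \<in> sets M" for i
    using P2 F2 by (auto simp: subalgebra_def)
  have disj: "disjoint_family P"
    by (auto simp: disjoint_family_on_def P_def)
  have step: "emeasure M (E i \<inter> P i) \<le>
      emeasure M (E i) * emeasure M (P i) + (\<integral>\<^sup>+\<omega>. e2ennreal (Y \<omega>) * indicator (P i) \<omega> \<partial>M)" for i
  proof -
    let ?c = "real_cond_exp M F2 (indicator (E i))"
    have int: "integrable M (indicator (E i) :: _ \<Rightarrow> real)"
      by (intro integrable_real_indicator) (simp_all add: emeasure_eq_measure)
    have nn: "AE \<omega> in M. 0 \<le> ?c \<omega>"
      by (intro F2.real_cond_exp_ge_c[OF int]) simp
    have "measure M (E i \<inter> P i) = (\<integral>\<omega>\<in>P i. indicator (E i) \<omega> \<partial>M)"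
      by (simp add: set_lebesgue_integral_def indicator_inter_arith[symmetric] Int_commute)
    also have "\<dots> = (\<integral>\<omega>\<in>P i. ?c \<omega> \<partial>M)"
      by (rule F2.real_cond_exp_intA[OF int P2])
    finally have "emeasure M (E i \<inter> P i) = ennreal (\<integral>\<omega>. indicator (P i) \<omega> * ?c \<omega> \<partial>M)"
      by (simp add: emeasure_eq_measure set_lebesgue_integral_def)
    also have "\<dots> = (\<integral>\<^sup>+\<omega>. ennreal (indicator (P i) \<omega> * ?c \<omega>) \<partial>M)"
    proof (rule nn_integral_eq_integral[symmetric])
      show "integrable M (\<lambda>\<omega>. indicator (P i) \<omega> * ?c \<omega>)"
        using integrable_mult_indicator[of "P i" M ?c] F2.real_cond_exp_int(1)[OF int] by simp
      show "AE \<omega> in M. 0 \<le> indicator (P i) \<omega> * ?c \<omega>"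
        using nn by eventually_elim simp
    qed
    also have "\<dots> \<le> (\<integral>\<^sup>+\<omega>. emeasure M (E i) * indicator (P i) \<omega> + e2ennreal (Y \<omega>) * indicator (P i) \<omega> \<partial>M)"
    proof (rule nn_integral_mono_AE)
      show "AE \<omega> in M. ennreal (indicator (P i) \<omega> * ?c \<omega>) \<le>
          emeasure M (E i) * indicator (P i) \<omega> + e2ennreal (Y \<omega>) * indicator (P i) \<omega>"
        using dom[OF E[of i]]
      proof eventually_elim
        case (elim \<omega>)
        have "ennreal (?c \<omega>) \<le> ennreal (measure M (E i) + \<bar>measure M (E i) - ?c \<omega>\<bar>)"
          by (rule ennreal_leI) auto
        also have "\<dots> = emeasure M (E i) + e2ennreal (ereal \<bar>measure M (E i) - ?c \<omega>\<bar>)"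
          by (simp add: emeasure_eq_measure e2ennreal_ereal)
        also have "\<dots> \<le> emeasure M (E i) + e2ennreal (Y \<omega>)"
          using elim by (intro add_mono e2ennreal_mono) auto
        finally show ?case
          by (simp add: indicator_def)
      qed
    qed
    also have "\<dots> = emeasure M (E i) * emeasure M (P i) + (\<integral>\<^sup>+\<omega>. e2ennreal (Y \<omega>) * indicator (P i) \<omega> \<partial>M)"
      by (simp add: nn_integral_add nn_integral_cmult)
    finally show ?thesis .
  qed
  have "emeasure M {\<omega> \<in> space M. \<omega> \<in> E (\<phi> \<omega>)} = emeasure M (\<Union>i. E i \<inter> P i)"
    by (rule arg_cong[where f = "emeasure M"]) (auto simp: P_def)
  also have "\<dots> = (\<Sum>i. emeasure M (E i \<inter> P i))"
    using disj by (intro suminf_emeasure[symmetric]) (auto simp: disjoint_family_on_def)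
  also have "\<dots> \<le> (\<Sum>i. emeasure M (E i) * emeasure M (P i) + (\<integral>\<^sup>+\<omega>. e2ennreal (Y \<omega>) * indicator (P i) \<omega> \<partial>M))"
    by (intro suminf_le step) auto
  also have "\<dots> = (\<Sum>i. emeasure M (E i) * emeasure M (P i)) + (\<Sum>i. \<integral>\<^sup>+\<omega>. e2ennreal (Y \<omega>) * indicator (P i) \<omega> \<partial>M)"
    by (intro suminf_add[symmetric]) auto
  also have "(\<Sum>i. \<integral>\<^sup>+\<omega>. e2ennreal (Y \<omega>) * indicator (P i) \<omega> \<partial>M) = (\<integral>\<^sup>+\<omega>\<in>(\<Union>i. P i). e2ennreal (Y \<omega>) \<partial>M)"
    by (intro nn_integral_disjoint_family[symmetric] disj) auto
  also have "\<dots> \<le> beta_dep M F1 F2"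
    unfolding beta by (intro nn_integral_mono) (auto simp: indicator_def)
  finally show ?thesis
    by (simp add: P_def add_left_mono)
qed

text \<open>For a set in the algebra, the product term of the random-section bound is exactly its
  mass under the product law, as the set is a disjoint union of rectangles. A general
  \<open>C\<close> is approximated under both laws at once, with an error that can be made
  arbitrarily small.\<close>

lemma emeasure_distr_pair_le_beta:
  assumes M: "prob_space M" and F1: "subalgebra M F1" and F2: "subalgebra M F2"
    and X: "X \<in> measurable F1 A" and Y: "Y \<in> measurable F2 B"
    and C: "C \<in> sets (A \<Otimes>\<^sub>M B)"
  shows "emeasure (distr M (A \<Otimes>\<^sub>M B) (\<lambda>\<omega>. (X \<omega>, Y \<omega>))) C \<le>
    emeasure (distr M A X \<Otimes>\<^sub>M distr M B Y) C + beta_dep M F1 F2"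
proof -
  interpret prob_space M by fact
  have XY[measurable]: "X \<in> measurable M A" "Y \<in> measurable M B"
    using measurable_from_subalg[OF F1 X] measurable_from_subalg[OF F2 Y] .
  define \<mu> where "\<mu> = distr M (A \<Otimes>\<^sub>M B) (\<lambda>\<omega>. (X \<omega>, Y \<omega>))"
  define \<nu> where "\<nu> = distr M A X \<Otimes>\<^sub>M distr M B Y"
  interpret PX: prob_space "distr M A X"
    by (rule prob_space_distr) measurable
  interpret PY: prob_space "distr M B Y"
    by (rule prob_space_distr) measurable
  interpret PP: pair_prob_space "distr M A X" "distr M B Y" ..
  interpret \<mu>: prob_space \<mu>
    unfolding \<mu>_def by (rule prob_space_distr) measurable
  interpret \<nu>: prob_space \<nu>
    unfolding \<nu>_def by unfold_locales
  have sets[simp]: "sets \<mu> = sets (A \<Otimes>\<^sub>M B)" "sets \<nu> = sets (A \<Otimes>\<^sub>M B)"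
    unfolding \<mu>_def \<nu>_def by (auto intro!: sets_pair_measure_cong del: equalityI subsetI)
  have elem: "emeasure \<mu> D \<le> emeasure \<nu> D + beta_dep M F1 F2"
    if D: "D \<in> countable_section_sets A B" for D
  proof -
    obtain E :: "nat \<Rightarrow> _" and \<phi> where E: "\<And>i. E i \<in> sets A"
      and \<phi>: "\<phi> \<in> measurable B (count_space UNIV)"
      and D_eq: "D = {p \<in> space A \<times> space B. fst p \<in> E (\<phi> (snd p))}"
      using D by (rule countable_section_setsE) blast
    have D_UN: "D = (\<Union>i. E i \<times> (\<phi> -` {i} \<inter> space B))"
      unfolding D_eq by (rule countable_section_sets_eq_UN) fact
    have P: "\<phi> -` {i} \<inter> space B \<in> sets B" for i
      using measurable_sets[OF \<phi>, of "{i}"] by simp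
    have sp: "X \<omega> \<in> space A" "Y \<omega> \<in> space B" if "\<omega> \<in> space M" for \<omega>
      using measurable_space[OF XY(1) that] measurable_space[OF XY(2) that] .
    have "emeasure \<mu> D = emeasure M ((\<lambda>\<omega>. (X \<omega>, Y \<omega>)) -` D \<inter> space M)"
      unfolding \<mu>_def D_UN using E P by (intro emeasure_distr) auto
    also have "(\<lambda>\<omega>. (X \<omega>, Y \<omega>)) -` D \<inter> space M =
        {\<omega> \<in> space M. \<omega> \<in> X -` E (\<phi> (Y \<omega>)) \<inter> space M}"
      using sp by (auto simp: D_eq)
    also have "emeasure M \<dots> \<le> (\<Sum>i. emeasure M (X -` E i \<inter> space M) *
        emeasure M ((\<lambda>\<omega>. \<phi> (Y \<omega>)) -` {i} \<inter> space M)) + beta_dep M F1 F2"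
    proof (rule emeasure_random_section_le[OF M F1 F2])
      show "X -` E i \<inter> space M \<in> sets F1" for i
        using measurable_sets[OF X E[of i]] F1 by (simp add: subalgebra_def)
      show "(\<lambda>\<omega>. \<phi> (Y \<omega>)) \<in> measurable F2 (count_space UNIV)"
        by (rule measurable_compose[OF Y \<phi>])
    qed
    also have "(\<Sum>i. emeasure M (X -` E i \<inter> space M) * emeasure M ((\<lambda>\<omega>. \<phi> (Y \<omega>)) -` {i} \<inter> space M)) =
        (\<Sum>i. emeasure \<nu> (E i \<times> (\<phi> -` {i} \<inter> space B)))"
    proof (rule suminf_cong)
      fix i
      have "(\<lambda>\<omega>. \<phi> (Y \<omega>)) -` {i} \<inter> space M = Y -` (\<phi> -` {i} \<inter> space B) \<inter> space M"
        using sp by auto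
      then show "emeasure M (X -` E i \<inter> space M) * emeasure M ((\<lambda>\<omega>. \<phi> (Y \<omega>)) -` {i} \<inter> space M) =
          emeasure \<nu> (E i \<times> (\<phi> -` {i} \<inter> space B))"
        unfolding \<nu>_def using E[of i] P[of i]
        by (subst PY.emeasure_pair_measure_Times) (simp_all add: emeasure_distr)
    qed
    also have "\<dots> = emeasure \<nu> D"
      unfolding D_UN using E P by (intro suminf_emeasure) (auto simp: disjoint_family_on_def)
    finally show ?thesis .
  qed
  have "emeasure \<mu> C \<le> emeasure \<nu> C + beta_dep M F1 F2"
  proof (rule ennreal_le_epsilon)
    fix e :: real assume e: "0 < e"
    obtain D where D: "D \<in> countable_section_sets A B"
      and De: "measure \<mu> (sym_diff C D) + measure \<nu> (sym_diff C D) < e"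
      using sigma_sets_approx_algebra[of \<mu> \<nu> "space A \<times> space B" "countable_section_sets A B" C e] e C
      by (auto simp: sigma_sets_countable_section_sets algebra_countable_section_sets
          intro: \<mu>.finite_measure_axioms \<nu>.finite_measure_axioms)
    have Ds: "D \<in> sets (A \<Otimes>\<^sub>M B)"
      using D sigma_sets_countable_section_sets[of A B] by (auto intro: sigma_sets.Basic)
    \<comment> \<open>The symmetric difference is paid for twice: under \<open>\<mu>\<close> on
      passing from \<open>C\<close> to \<open>D\<close>, under \<open>\<nu>\<close> on returning
      from \<open>D\<close> to \<open>C\<close>.\<close>
    have "emeasure \<mu> C \<le> emeasure \<mu> (D \<union> sym_diff C D)"
      using C Ds by (intro emeasure_mono) auto
    also have "\<dots> \<le> emeasure \<mu> D + emeasure \<mu> (sym_diff C D)"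
      using C Ds by (intro emeasure_subadditive) auto
    also have "emeasure \<mu> D \<le> emeasure \<nu> D + beta_dep M F1 F2"
      by (rule elem[OF D])
    also have "emeasure \<nu> D \<le> emeasure \<nu> (C \<union> sym_diff C D)"
      using C Ds by (intro emeasure_mono) auto
    also have "\<dots> \<le> emeasure \<nu> C + emeasure \<nu> (sym_diff C D)"
      using C Ds by (intro emeasure_subadditive) auto
    finally have "emeasure \<mu> C \<le> (emeasure \<nu> C + beta_dep M F1 F2) +
        (emeasure \<mu> (sym_diff C D) + emeasure \<nu> (sym_diff C D))"
      by (simp add: add_left_mono add_right_mono ac_simps)
    also have "emeasure \<mu> (sym_diff C D) + emeasure \<nu> (sym_diff C D) \<le> ennreal e"
      using De by (simp add: \<mu>.emeasure_eq_measure \<nu>.emeasure_eq_measure ennreal_leI less_imp_le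
          flip: ennreal_plus)
    finally show "emeasure \<mu> C \<le> emeasure \<nu> C + beta_dep M F1 F2 + ennreal e"
      by (simp add: add_left_mono)
  qed
  then show ?thesis
    by (simp add: \<mu>_def \<nu>_def)
qed

section \<open>From pairs to whole blocks: peeling off the largest index\<close>

lemma measurable_gen_sigma:
  assumes "\<And>i. i \<in> K \<Longrightarrow> Z i \<in> measurable M (borel_of (S i))" and k: "k \<in> K"
  shows "Z k \<in> measurable (gen_sigma M S Z K) (borel_of (S k))"
proof -
  have "Z i \<omega> \<in> space (borel_of (S i))" if "i \<in> K" "\<omega> \<in> space M" for i \<omega>
    using measurable_space[OF assms(1) that(2)] that(1) .
  then have "(\<lambda>\<omega>. \<lambda>i\<in>K. Z i \<omega>) \<in> measurable (gen_sigma M S Z K) (Pi\<^sub>M K (\<lambda>i. borel_of (S i)))"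
    unfolding gen_sigma_def by (intro measurable_vimage_algebra1) (auto simp: space_PiM)
  from measurable_compose[OF this measurable_component_singleton[OF k]] show ?thesis
    using k by simp
qed

lemma subalgebra_gen_sigma:
  assumes "\<And>i. i \<in> K \<Longrightarrow> Z i \<in> measurable M (borel_of (S i))"
  shows "subalgebra M (gen_sigma M S Z K)"
proof -
  have "(\<lambda>\<omega>. \<lambda>i\<in>K. Z i \<omega>) \<in> measurable M (Pi\<^sub>M K (\<lambda>i. borel_of (S i)))"
    using assms by (rule measurable_restrict)
  then show ?thesis
    unfolding subalgebra_def gen_sigma_def by (simp add: sets_image_in_sets)
qed

text \<open>Induction on the largest element \<open>l\<close>: the pair bound splits off
  \<open>Z l\<close>, and the induction hypothesis is then used on each slice, hence for arbitrary
  \<open>A\<close>. Index 0 is excluded because the pasts \<open>{1..l - m}\<close> and the range of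
  \<open>l\<close> in \<open>beta_coeff\<close> both start at 1.\<close>

lemma emeasure_distr_restrict_le_beta:
  fixes S :: "nat \<Rightarrow> 'a topology"
  assumes M: "prob_space M" and Z: "\<And>k. k \<in> I \<Longrightarrow> Z k \<in> measurable M (borel_of (S k))"
    and I: "0 \<notin> I" and m: "0 < m"
    and K: "finite K" "K \<subseteq> I" "\<And>i j. i \<in> K \<Longrightarrow> j \<in> K \<Longrightarrow> i < j \<Longrightarrow> i + m \<le> j"
    and A: "A \<in> sets (Pi\<^sub>M K (\<lambda>k. borel_of (S k)))"
  shows "emeasure (distr M (Pi\<^sub>M K (\<lambda>k. borel_of (S k))) (\<lambda>\<omega>. \<lambda>k\<in>K. Z k \<omega>)) A \<le>
    emeasure (Pi\<^sub>M K (\<lambda>k. distr M (borel_of (S k)) (Z k))) A + of_nat (card K) * beta_coeff M S I Z m"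
  using K A
proof (induction K arbitrary: A rule: finite_linorder_max_induct)
  case empty
  interpret prob_space M by fact
  interpret D: prob_space "distr M (Pi\<^sub>M {} (\<lambda>k. borel_of (S k))) (\<lambda>\<omega>. \<lambda>k\<in>{}. Z k \<omega>)"
    by (intro prob_space_distr measurable_restrict) simp
  have "A = {} \<or> A = {\<lambda>_. undefined}"
    using empty(3) by (auto simp: PiM_empty)
  then have "emeasure (distr M (Pi\<^sub>M {} (\<lambda>k. borel_of (S k))) (\<lambda>\<omega>. \<lambda>k\<in>{}. Z k \<omega>)) A \<le>
      emeasure (Pi\<^sub>M {} (\<lambda>k. distr M (borel_of (S k)) (Z k))) A"
  proof
    assume "A = {\<lambda>_. undefined}"
    then have "emeasure (Pi\<^sub>M {} (\<lambda>k. distr M (borel_of (S k)) (Z k))) A = 1"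
      by (simp add: emeasure_PiM_empty)
    then show ?thesis
      using D.emeasure_le_1[of A] by (simp only:)
  qed simp
  then show ?case
    by (simp only: card.empty of_nat_0 mult_zero_left add_0_right)
next
  case (insert l K)
  interpret prob_space M by fact
  define N where "N = (\<lambda>k. borel_of (S k))"
  \<comment> \<open>\<open>product_prob_space\<close> demands a probability measure at every index.
    Outside \<open>I\<close> nothing is assumed about \<open>Z k\<close>, so a point mass fills the
    gap there; on \<open>insert l K\<close> the family consists of the true marginals.\<close>
  define P where "P = (\<lambda>k. if k \<in> I then distr M (N k) (Z k) else return (count_space UNIV) undefined)"
  have ZN[measurable]: "Z k \<in> measurable M (N k)" if "k \<in> insert l K" for k
    using Z that insert.prems by (auto simp: N_def)
  have "prob_space (P k)" for k
    unfolding P_def using Z by (auto simp: N_def intro!: prob_space_distr prob_space_return)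
  then interpret P: product_prob_space P
    by (simp add: product_prob_space_def product_prob_space_axioms_def product_sigma_finite_def
        prob_space_imp_sigma_finite)
  have P_eq: "P k = distr M (N k) (Z k)" if "k \<in> insert l K" for k
    using that insert.prems by (auto simp: P_def)
  have setsP: "sets (P k) = sets (N k)" if "k \<in> insert l K" for k
    using P_eq[OF that] by simp
  have PK: "Pi\<^sub>M K P = Pi\<^sub>M K (\<lambda>k. distr M (N k) (Z k))"
    by (intro PiM_cong) (auto simp: P_eq)
  have PlK: "Pi\<^sub>M (insert l K) P = Pi\<^sub>M (insert l K) (\<lambda>k. distr M (N k) (Z k))"
    by (intro PiM_cong) (auto simp: P_eq)
  have lK: "l \<notin> K"
    using insert.hyps by auto
  let ?ZK = "\<lambda>\<omega>. \<lambda>k\<in>K. Z k \<omega>"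
  let ?DK = "distr M (Pi\<^sub>M K N) ?ZK"
  let ?b = "beta_coeff M S I Z m"
  have A[measurable]: "A \<in> sets (Pi\<^sub>M (insert l K) N)"
    using insert.prems by (simp add: N_def)
  define f where "f = (\<lambda>(x, y). x(l := y :: 'a))"
  have f[measurable]: "f \<in> measurable (Pi\<^sub>M K N \<Otimes>\<^sub>M N l) (Pi\<^sub>M (insert l K) N)"
    unfolding f_def by (rule measurable_add_dim)
  define C where "C = f -` A \<inter> space (Pi\<^sub>M K N \<Otimes>\<^sub>M N l)"
  have C[measurable]: "C \<in> sets (Pi\<^sub>M K N \<Otimes>\<^sub>M N l)"
    unfolding C_def by measurable
  have ZK[measurable]: "?ZK \<in> measurable M (Pi\<^sub>M K N)"
    by (intro measurable_restrict ZN) auto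
  have ZlK[measurable]: "(\<lambda>\<omega>. \<lambda>k\<in>insert l K. Z k \<omega>) \<in> measurable M (Pi\<^sub>M (insert l K) N)"
    by (intro measurable_restrict ZN) auto
  interpret DK: prob_space ?DK
    by (rule prob_space_distr) measurable
  interpret Pl: prob_space "distr M (N l) (Z l)"
    by (rule prob_space_distr) measurable
  interpret PP: pair_sigma_finite ?DK "distr M (N l) (Z l)" ..
  have f_Z: "f (?ZK \<omega>, Z l \<omega>) = (\<lambda>k\<in>insert l K. Z k \<omega>)" for \<omega>
    using lK by (auto simp: f_def fun_eq_iff)
  let ?F1 = "gen_sigma M S Z (I \<inter> {1..l - m})" and ?F2 = "gen_sigma M S Z (I \<inter> {l})"
  have beta: "beta_dep M ?F1 ?F2 \<le> ?b"
  proof -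
    have "1 \<le> l"
      using insert.prems I by (cases l) auto
    then show ?thesis
      unfolding beta_coeff_def beta_coeff_at_def by (intro SUP_upper2[of l]) auto
  qed
  have sec: "(\<lambda>x. (x, y)) -` C = (\<lambda>x. x(l := y)) -` A \<inter> space (Pi\<^sub>M K N)" if "y \<in> space (N l)" for y
    using that by (auto simp: C_def f_def space_pair_measure)
  have "emeasure (distr M (Pi\<^sub>M (insert l K) N) (\<lambda>\<omega>. \<lambda>k\<in>insert l K. Z k \<omega>)) A =
      emeasure (distr M (Pi\<^sub>M K N \<Otimes>\<^sub>M N l) (\<lambda>\<omega>. (?ZK \<omega>, Z l \<omega>))) C"
    by (simp add: emeasure_distr) (rule arg_cong[where f = "emeasure M"],
      use measurable_space[OF ZK] measurable_space[OF ZN[of l]] in \<open>auto simp: C_def f_Z space_pair_measure\<close>)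
  also have "\<dots> \<le> emeasure (?DK \<Otimes>\<^sub>M distr M (N l) (Z l)) C + beta_dep M ?F1 ?F2"
  proof (rule emeasure_distr_pair_le_beta[OF M])
    show "subalgebra M ?F1" "subalgebra M ?F2"
      using Z by (auto intro!: subalgebra_gen_sigma)
    show "?ZK \<in> measurable ?F1 (Pi\<^sub>M K N)"
    proof (rule measurable_restrict)
      \<comment> \<open>Here the spacing matters: since \<open>l\<close> is the largest index, all
        of \<open>K\<close> lies in the past at lag \<open>m\<close>.\<close>
      fix k assume k: "k \<in> K"
      then have "k + m \<le> l" "k \<in> I"
        using insert.hyps insert.prems by auto
      moreover have "k \<noteq> 0"
        using \<open>k \<in> I\<close> I by metis
      ultimately have "k \<in> I \<inter> {1..l - m}"
        by auto
      then show "Z k \<in> measurable ?F1 (N k)"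
        unfolding N_def using Z by (intro measurable_gen_sigma) auto
    qed
    show "Z l \<in> measurable ?F2 (N l)"
      unfolding N_def using Z insert.prems by (intro measurable_gen_sigma) auto
  qed (rule C)
  also have "emeasure (?DK \<Otimes>\<^sub>M distr M (N l) (Z l)) C =
      (\<integral>\<^sup>+y. emeasure ?DK ((\<lambda>x. (x, y)) -` C) \<partial>distr M (N l) (Z l))"
    using C sets_pair_measure_cong[of ?DK "Pi\<^sub>M K N" "distr M (N l) (Z l)" "N l"]
    by (intro PP.emeasure_pair_measure_alt2) auto
  \<comment> \<open>Integrating over the last coordinate outermost makes every inner set a slice
    over \<open>K\<close>, to which the induction hypothesis applies for each \<open>y\<close>. Its
    additive error is constant in \<open>y\<close> and so survives the integration against a
    probability measure unchanged.\<close>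
  also have "\<dots> \<le> (\<integral>\<^sup>+y. emeasure (Pi\<^sub>M K P) ((\<lambda>x. (x, y)) -` C) + of_nat (card K) * ?b \<partial>distr M (N l) (Z l))"
  proof (rule nn_integral_mono)
    fix y assume "y \<in> space (distr M (N l) (Z l))"
    have "(\<lambda>x. (x, y)) -` C \<in> sets (Pi\<^sub>M K N)"
      using C by (rule sets_Pair2)
    then show "emeasure ?DK ((\<lambda>x. (x, y)) -` C) \<le> emeasure (Pi\<^sub>M K P) ((\<lambda>x. (x, y)) -` C) + of_nat (card K) * ?b"
      unfolding PK N_def using insert.prems by (intro insert.IH) auto
  qed
  also have "\<dots> = (\<integral>\<^sup>+y. emeasure (Pi\<^sub>M K P) ((\<lambda>x. (x, y)) -` C) \<partial>distr M (N l) (Z l)) + of_nat (card K) * ?b"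
  proof -
    interpret PK: prob_space "Pi\<^sub>M K P"
      by (intro prob_space_PiM P.prob_space)
    have "sets (Pi\<^sub>M K P) = sets (Pi\<^sub>M K N)"
      by (intro sets_PiM_cong) (auto simp: setsP)
    then have "C \<in> sets (Pi\<^sub>M K P \<Otimes>\<^sub>M distr M (N l) (Z l))"
      using C sets_pair_measure_cong[of "Pi\<^sub>M K P" "Pi\<^sub>M K N" "distr M (N l) (Z l)" "N l"] by auto
    moreover have "pair_sigma_finite (Pi\<^sub>M K P) (distr M (N l) (Z l))" ..
    ultimately have "(\<lambda>y. emeasure (Pi\<^sub>M K P) ((\<lambda>x. (x, y)) -` C)) \<in> borel_measurable (distr M (N l) (Z l))"
      by (intro pair_sigma_finite.measurable_emeasure_Pair2)
    then show ?thesis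
      using Pl.emeasure_space_1 by (subst nn_integral_add) auto
  qed
  also have "(\<integral>\<^sup>+y. emeasure (Pi\<^sub>M K P) ((\<lambda>x. (x, y)) -` C) \<partial>distr M (N l) (Z l)) =
      emeasure (Pi\<^sub>M (insert l K) P) A"
  proof -
    have setsKl: "sets (Pi\<^sub>M (insert l K) P) = sets (Pi\<^sub>M (insert l K) N)"
        "sets (Pi\<^sub>M K P) = sets (Pi\<^sub>M K N)"
      by (intro sets_PiM_cong; simp add: setsP)+
    have spK: "space (Pi\<^sub>M K P) = space (Pi\<^sub>M K N)"
      by (intro sets_eq_imp_space_eq setsKl)
    have A_P: "A \<in> sets (Pi\<^sub>M (insert l K) P)"
      using A setsKl(1) by simp
    then have "emeasure (Pi\<^sub>M (insert l K) P) A = (\<integral>\<^sup>+x. indicator A x \<partial>Pi\<^sub>M (insert l K) P)"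
      by simp
    also have "\<dots> = (\<integral>\<^sup>+y. (\<integral>\<^sup>+x. indicator A (x(l := y)) \<partial>Pi\<^sub>M K P) \<partial>P l)"
      using insert.hyps lK A_P by (intro P.product_nn_integral_insert_rev) auto
    also have "\<dots> = (\<integral>\<^sup>+y. emeasure (Pi\<^sub>M K P) ((\<lambda>x. (x, y)) -` C) \<partial>P l)"
    proof (rule nn_integral_cong)
      fix y assume "y \<in> space (P l)"
      then have y: "y \<in> space (N l)"
        by (simp add: P_eq)
      have "(\<integral>\<^sup>+x. indicator A (x(l := y)) \<partial>Pi\<^sub>M K P) = (\<integral>\<^sup>+x. indicator ((\<lambda>x. (x, y)) -` C) x \<partial>Pi\<^sub>M K P)"
        using y by (intro nn_integral_cong) (auto simp: sec spK indicator_def)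
      also have "\<dots> = emeasure (Pi\<^sub>M K P) ((\<lambda>x. (x, y)) -` C)"
        using sets_Pair2[OF C] setsKl by simp
      finally show "(\<integral>\<^sup>+x. indicator A (x(l := y)) \<partial>Pi\<^sub>M K P) = emeasure (Pi\<^sub>M K P) ((\<lambda>x. (x, y)) -` C)" .
    qed
    finally show ?thesis
      by (simp add: P_eq)
  qed
  also have "emeasure (Pi\<^sub>M (insert l K) P) A + of_nat (card K) * ?b + beta_dep M ?F1 ?F2 \<le>
      emeasure (Pi\<^sub>M (insert l K) P) A + of_nat (card (insert l K)) * ?b"
    using beta insert.hyps lK by (simp add: add.assoc distrib_right add.commute add_left_mono)
  finally show ?case
    by (simp add: PlK N_def add_right_mono)
qed

section \<open>Residue classes and suprema over blocks\<close>

text \<open>Shifting the indices to \<open>0..n - 1\<close> makes the residues below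
  \<open>r\<close> exactly those with an extra element: after \<open>q\<close> full rounds of length
  \<open>m\<close>, the incomplete round covers the residues \<open>0..r - 1\<close>.\<close>

lemma residue_class_eq_image:
  fixes n m q r i :: nat
  assumes "n = q * m + r" "r < m" "i < m"
  shows "{j \<in> {1..n}. (j - 1) mod m = i} = (\<lambda>k. Suc (i + k * m)) ` {..<q + of_bool (i < r)}"
proof (intro equalityI subsetI)
  fix j assume j: "j \<in> {j \<in> {1..n}. (j - 1) mod m = i}"
  define k where "k = (j - 1) div m"
  have jk: "j = Suc (i + k * m)"
    using j div_mult_mod_eq[of "j - 1" m] by (auto simp: k_def)
  have "k < q + of_bool (i < r)"
  proof (rule ccontr)
    assume k: "\<not> k < q + of_bool (i < r)"
    have less: "i + k * m < q * m + r"
      using j jk assms(1) by simp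
    show False
    proof (cases "i < r")
      case True
      with k have "Suc q * m \<le> k * m"
        by (intro mult_le_mono1) simp
      with less assms(2) show False
        unfolding mult_Suc by linarith
    next
      case False
      with k have "q * m \<le> k * m"
        by (intro mult_le_mono1) simp
      with less False show False
        by linarith
    qed
  qed
  with jk show "j \<in> (\<lambda>k. Suc (i + k * m)) ` {..<q + of_bool (i < r)}"
    by blast
next
  fix j assume "j \<in> (\<lambda>k. Suc (i + k * m)) ` {..<q + of_bool (i < r)}"
  then obtain k where k: "k < q + of_bool (i < r)" and j: "j = Suc (i + k * m)"
    by blast
  have "i + k * m < n"
  proof (cases "i < r")
    case True
    with k have "k * m \<le> q * m"
      by (intro mult_le_mono1) simp
    with True assms(1) show ?thesis
      by linarith
  next
    case False
    with k have "Suc k * m \<le> q * m"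
      by (intro mult_le_mono1) simp
    with assms show ?thesis
      unfolding mult_Suc by linarith
  qed
  with j assms(3) show "j \<in> {j \<in> {1..n}. (j - 1) mod m = i}"
    by simp
qed

lemma card_residue_class:
  fixes n m q r i :: nat
  assumes "n = q * m + r" "r < m" "i < m"
  shows "card {j \<in> {1..n}. (j - 1) mod m = i} = q + of_bool (i < r)"
proof -
  have "inj_on (\<lambda>k. Suc (i + k * m)) {..<q + of_bool (i < r)}"
    using assms by (auto simp: inj_on_def)
  then show ?thesis
    unfolding residue_class_eq_image[OF assms] by (simp add: card_image)
qed

lemma mod_eq_imp_add_le:
  fixes i j m :: nat
  assumes "i mod m = j mod m" "i < j"
  shows "i + m \<le> j"
proof -
  have "m dvd j - i"
    using assms by (metis less_imp_le mod_eq_dvd_iff_nat)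
  with assms(2) show ?thesis
    using dvd_imp_le[of m "j - i"] by auto
qed

lemma average_UN_disjoint:
  fixes f :: "'j \<Rightarrow> real"
  assumes "finite I" "\<And>i. i \<in> I \<Longrightarrow> finite (J i)" "disjoint_family_on J I"
  shows "(\<Sum>j\<in>(\<Union>i\<in>I. J i). f j) / c = (\<Sum>i\<in>I. real (card (J i)) / c * ((\<Sum>j\<in>J i. f j) / real (card (J i))))"
proof -
  have "(\<Sum>j\<in>(\<Union>i\<in>I. J i). f j) = (\<Sum>i\<in>I. \<Sum>j\<in>J i. f j)"
    using assms by (intro sum.UNION_disjoint) (auto simp: disjoint_family_on_def)
  moreover have "(\<Sum>j\<in>J i. f j) / c = real (card (J i)) / c * ((\<Sum>j\<in>J i. f j) / real (card (J i)))"
    if "i \<in> I" for i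
    using assms(2)[OF that] by (cases "J i = {}") auto
  ultimately show ?thesis
    by (simp add: sum_divide_distrib)
qed

text \<open>The supremum of a convex combination is at most the largest of the suprema. Suprema are
  compared rather than single \<open>g\<close>, because the value \<open>t\<close> need not be
  attained.\<close>

lemma le_SUP_convex_combination:
  fixes d :: "'i \<Rightarrow> 'g \<Rightarrow> real" and w :: "'i \<Rightarrow> real"
  assumes I: "finite I" and w: "\<And>i. i \<in> I \<Longrightarrow> 0 \<le> w i" "(\<Sum>i\<in>I. w i) = 1"
    and t: "ereal t \<le> (SUP g\<in>G. ereal (\<Sum>i\<in>I. w i * d i g))"
  shows "\<exists>i\<in>I. ereal t \<le> (SUP g\<in>G. ereal (d i g))"
proof (rule ccontr)
  assume "\<not> ?thesis"
  then have lt: "(SUP g\<in>G. ereal (d i g)) < ereal t" if "i \<in> I" for i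
    using that by (auto simp: not_le)
  have "I \<noteq> {}"
    using w(2) by auto
  then have "Max ((\<lambda>i. SUP g\<in>G. ereal (d i g)) ` I) < ereal t"
    using I lt by (subst Max_less_iff) auto
  \<comment> \<open>A real number in the gap keeps the averaging in the reals, although the suprema
    are extended: for empty \<open>G\<close> they are minus infinity. The gap exists because
    \<open>I\<close> is finite.\<close>
  then obtain c where c: "Max ((\<lambda>i. SUP g\<in>G. ereal (d i g)) ` I) < ereal c" "ereal c < ereal t"
    by (blast dest: ereal_dense2)
  have d: "d i g \<le> c" if "i \<in> I" "g \<in> G" for i g
  proof -
    have "ereal (d i g) \<le> (SUP g\<in>G. ereal (d i g))"
      using that by (intro SUP_upper)
    also have "\<dots> \<le> Max ((\<lambda>i. SUP g\<in>G. ereal (d i g)) ` I)"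
      using that(1) I by (intro Max_ge finite_imageI imageI)
    also note c(1)
    finally show ?thesis
      by simp
  qed
  have "(\<Sum>i\<in>I. w i * d i g) \<le> c" if "g \<in> G" for g
  proof -
    have "(\<Sum>i\<in>I. w i * d i g) \<le> (\<Sum>i\<in>I. w i * c)"
      using w(1) d that by (intro sum_mono mult_left_mono) auto
    also have "\<dots> = c"
      using w(2) by (simp flip: sum_distrib_right)
    finally show ?thesis .
  qed
  then have "(SUP g\<in>G. ereal (\<Sum>i\<in>I. w i * d i g)) \<le> ereal c"
    by (intro SUP_least) auto
  with t c(2) show False
    using order_trans[OF t, of "ereal c"] by simp
qed

section \<open>Events of suprema: dependence on the law only, and the almost sure bound\<close>

lemma emp_mean_restrict_sample:
  "emp_mean J Z g \<omega> = emp_mean J (\<lambda>j z. z j) g (\<lambda>j\<in>J. Z j \<omega>)"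
  by (simp add: emp_mean_def cong: sum.cong)

lemma SUP_coord_proj:
  "(SUP g\<in>coord_proj J G. ereal (a * emp_mean J Z g \<omega> + b * pop_mean M S J X g)) =
   (SUP g\<in>G. ereal (a * emp_mean J Z g \<omega> + b * pop_mean M S J X g))"
  by (simp add: coord_proj_def image_comp emp_mean_def pop_mean_def cong: sum.cong)

text \<open>The sample \<open>Z'\<close> varies while the centring stays that of \<open>Z\<close>,
  so the set \<open>A\<close> does not depend on \<open>Z'\<close>. Applied to the original sample
  and to the independent one, this turns both events into masses of one set \<open>A\<close> under
  two laws.\<close>

lemma measurable_sup_event:
  fixes t :: real
  assumes "measurable_sup M S Z G a b J"
    and Z': "\<And>j. j \<in> J \<Longrightarrow> Z' j \<in> measurable M' (borel_of (S j))"
  defines "N \<equiv> Pi\<^sub>M J (\<lambda>j. borel_of (S j))"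
  defines "A \<equiv> {z \<in> space N. ereal t \<le>
    (SUP g\<in>coord_proj J G. ereal (a * emp_mean J (\<lambda>j z. z j) g z + b * pop_mean M S J Z g))}"
  defines "D \<equiv> {\<omega> \<in> space M'. ereal t \<le>
    (SUP g\<in>coord_proj J G. ereal (a * emp_mean J Z' g \<omega> + b * pop_mean M S J Z g))}"
  shows "A \<in> sets N" "D \<in> sets M'" "emeasure (distr M' N (\<lambda>\<omega>. \<lambda>j\<in>J. Z' j \<omega>)) A = emeasure M' D"
proof -
  let ?F = "\<lambda>z. SUP g\<in>coord_proj J G. ereal (a * emp_mean J (\<lambda>j z. z j) g z + b * pop_mean M S J Z g)"
  have [measurable]: "?F \<in> borel_measurable N"
    using assms(1) by (simp add: measurable_sup_def N_def)
  show A: "A \<in> sets N"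
    unfolding A_def by measurable
  have ZJ: "(\<lambda>\<omega>. \<lambda>j\<in>J. Z' j \<omega>) \<in> measurable M' N"
    unfolding N_def using Z' by (intro measurable_restrict)
  have D: "D = (\<lambda>\<omega>. \<lambda>j\<in>J. Z' j \<omega>) -` A \<inter> space M'"
    using measurable_space[OF ZJ]
    by (auto simp: D_def A_def emp_mean_restrict_sample[of J Z'])
  show "D \<in> sets M'"
    unfolding D by (rule measurable_sets[OF ZJ A])
  show "emeasure (distr M' N (\<lambda>\<omega>. \<lambda>j\<in>J. Z' j \<omega>)) A = emeasure M' D"
    unfolding D by (rule emeasure_distr[OF ZJ A])
qed

lemma emeasure_block_sup_le:
  fixes M :: "'w measure" and M' :: "'v measure" and S :: "nat \<Rightarrow> 'a topology"
  assumes M: "prob_space M" and Z: "\<And>k. k \<in> I \<Longrightarrow> Z k \<in> measurable M (borel_of (S k))"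
    and I: "0 \<notin> I" and m: "0 < m"
    and J: "finite J" "J \<noteq> {}" "J \<subseteq> I" "\<And>i j. i \<in> J \<Longrightarrow> j \<in> J \<Longrightarrow> i < j \<Longrightarrow> i + m \<le> j"
    and ms: "measurable_sup M S Z G a b J"
    and M': "prob_space M'" and indep: "prob_space.indep_vars M' (\<lambda>j. borel_of (S j)) Z' J"
    and same: "\<And>j. j \<in> J \<Longrightarrow> distr M' (borel_of (S j)) (Z' j) = distr M (borel_of (S j)) (Z j)"
  shows "emeasure M {\<omega> \<in> space M. ereal t \<le>
        (SUP g\<in>coord_proj J G. ereal (a * emp_mean J Z g \<omega> + b * pop_mean M S J Z g))} \<le>
      emeasure M' {\<omega> \<in> space M'. ereal t \<le>
        (SUP g\<in>coord_proj J G. ereal (a * emp_mean J Z' g \<omega> + b * pop_mean M S J Z g))} +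
      of_nat (card J) * beta_coeff M S I Z m"
proof -
  interpret M': prob_space M' by fact
  have ZJ: "\<And>j. j \<in> J \<Longrightarrow> Z j \<in> measurable M (borel_of (S j))"
    using Z J by auto
  have Z': "\<And>j. j \<in> J \<Longrightarrow> Z' j \<in> measurable M' (borel_of (S j))"
    using indep by (simp add: M'.indep_vars_def)
  have "distr M' (Pi\<^sub>M J (\<lambda>j. borel_of (S j))) (\<lambda>\<omega>. \<lambda>j\<in>J. Z' j \<omega>) =
      Pi\<^sub>M J (\<lambda>j. distr M' (borel_of (S j)) (Z' j))"
    using M'.indep_vars_iff_distr_eq_PiM'[OF J(2) Z'] indep by simp
  also have "\<dots> = Pi\<^sub>M J (\<lambda>j. distr M (borel_of (S j)) (Z j))"
    by (intro PiM_cong refl same)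
  finally have law: "distr M' (Pi\<^sub>M J (\<lambda>j. borel_of (S j))) (\<lambda>\<omega>. \<lambda>j\<in>J. Z' j \<omega>) =
      Pi\<^sub>M J (\<lambda>j. distr M (borel_of (S j)) (Z j))" .
  let ?A = "{z \<in> space (Pi\<^sub>M J (\<lambda>j. borel_of (S j))). ereal t \<le>
    (SUP g\<in>coord_proj J G. ereal (a * emp_mean J (\<lambda>j z. z j) g z + b * pop_mean M S J Z g))}"
  have "emeasure (distr M (Pi\<^sub>M J (\<lambda>k. borel_of (S k))) (\<lambda>\<omega>. \<lambda>k\<in>J. Z k \<omega>)) ?A \<le>
      emeasure (distr M' (Pi\<^sub>M J (\<lambda>j. borel_of (S j))) (\<lambda>\<omega>. \<lambda>j\<in>J. Z' j \<omega>)) ?A +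
      of_nat (card J) * beta_coeff M S I Z m"
    unfolding law
    by (intro emeasure_distr_restrict_le_beta[OF M Z I m J(1,3,4)] measurable_sup_event(1)[OF ms ZJ])
  then show ?thesis
    by (simp only: measurable_sup_event(3)[OF ms ZJ] measurable_sup_event(3)[OF ms Z'])
qed

lemma AE_sup_le_bound:
  fixes S :: "nat \<Rightarrow> 'a topology" and B :: real
  assumes M: "prob_space M" and J: "finite J" "J \<noteq> {}"
    and Z: "\<And>k. k \<in> J \<Longrightarrow> Z k \<in> measurable M (borel_of (S k))"
    and g: "\<And>g k. g \<in> G \<Longrightarrow> k \<in> J \<Longrightarrow> g k \<in> borel_measurable (borel_of (S k))"
    and bd: "\<And>g k. g \<in> G \<Longrightarrow> k \<in> J \<Longrightarrow> AE \<omega> in M. \<bar>g k (Z k \<omega>)\<bar> \<le> B"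
    and sep: "separable_sup M S Z G a b J"
  shows "AE \<omega> in M. (SUP g\<in>G. ereal (a * emp_mean J Z g \<omega> + b * pop_mean M S J Z g)) \<le>
    ereal ((\<bar>a\<bar> + \<bar>b\<bar>) * B)"
proof -
  interpret prob_space M by fact
  obtain G0 where G0: "G0 \<subseteq> G" "countable G0"
    and eq: "AE \<omega> in M. (SUP g\<in>G. ereal (a * emp_mean J Z g \<omega> + b * pop_mean M S J Z g))
                  = (SUP g\<in>G0. ereal (a * emp_mean J Z g \<omega> + b * pop_mean M S J Z g))"
    using sep unfolding separable_sup_def by blast
  have mean: "\<bar>(\<Sum>j\<in>J. f j) / real (card J)\<bar> \<le> B" if "\<And>j. j \<in> J \<Longrightarrow> \<bar>f j\<bar> \<le> B" for f :: "nat \<Rightarrow> real"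
  proof -
    have "\<bar>\<Sum>j\<in>J. f j\<bar> \<le> (\<Sum>j\<in>J. B)"
      using that by (intro order_trans[OF sum_abs] sum_mono)
    then show ?thesis
      using J by (simp add: abs_divide field_simps card_gt_0_iff)
  qed
  have pop: "\<bar>pop_mean M S J Z g\<bar> \<le> B" if "g \<in> G" for g
    unfolding pop_mean_def
  proof (rule mean)
    fix j assume j: "j \<in> J"
    have [measurable]: "Z j \<in> measurable M (borel_of (S j))" "g j \<in> borel_measurable (borel_of (S j))"
      using Z g that j by auto
    have int: "integrable M (\<lambda>\<omega>. g j (Z j \<omega>))"
      using bd[OF that j] by (intro integrable_const_bound[of _ B]) auto
    have "\<bar>\<integral>\<omega>. g j (Z j \<omega>) \<partial>M\<bar> \<le> (\<integral>\<omega>. \<bar>g j (Z j \<omega>)\<bar> \<partial>M)"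
      by (rule integral_abs_bound)
    also have "\<dots> \<le> B"
      using bd[OF that j] int by (intro integral_le_const) auto
    finally show "\<bar>\<integral>z. g j z \<partial>distr M (borel_of (S j)) (Z j)\<bar> \<le> B"
      by (simp add: integral_distr)
  qed
  \<comment> \<open>The exceptional null sets can be merged because \<open>G0\<close> is countable
    and \<open>J\<close> finite.\<close>
  have "AE \<omega> in M. \<forall>g\<in>G0. \<forall>k\<in>J. \<bar>g k (Z k \<omega>)\<bar> \<le> B"
    using bd G0 J by (simp add: AE_ball_countable AE_finite_all subset_iff countable_finite)
  with eq show ?thesis
  proof eventually_elim
    case (elim \<omega>)
    have "a * emp_mean J Z g \<omega> + b * pop_mean M S J Z g \<le> (\<bar>a\<bar> + \<bar>b\<bar>) * B" if "g \<in> G0" for g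
    proof -
      have "\<bar>emp_mean J Z g \<omega>\<bar> \<le> B"
        unfolding emp_mean_def using elim that by (intro mean) auto
      then have "\<bar>a\<bar> * \<bar>emp_mean J Z g \<omega>\<bar> + \<bar>b\<bar> * \<bar>pop_mean M S J Z g\<bar> \<le> \<bar>a\<bar> * B + \<bar>b\<bar> * B"
        using pop[of g] that G0 by (intro add_mono mult_left_mono) auto
      moreover have "a * emp_mean J Z g \<omega> \<le> \<bar>a\<bar> * \<bar>emp_mean J Z g \<omega>\<bar>"
        "b * pop_mean M S J Z g \<le> \<bar>b\<bar> * \<bar>pop_mean M S J Z g\<bar>"
        by (metis abs_ge_self abs_mult)+
      ultimately show ?thesis
        by (simp add: distrib_right)
    qed
    then show ?case
      unfolding elim(1) by (intro SUP_least) auto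
  qed
qed

section \<open>Summation over the residue classes and truncation in \<open>t\<close>\<close>

theorem proposition2p14:
  fixes M :: "'w measure" and S :: "nat \<Rightarrow> 'a topology" and Z :: "nat \<Rightarrow> 'w \<Rightarrow> 'a"
    and G :: "(nat \<Rightarrow> 'a \<Rightarrow> real) set" and a b :: real and B :: ereal
    and L :: "nat \<Rightarrow> ereal \<Rightarrow> real" and n m q r :: nat and t :: real
  assumes "prob_space M"
    and "1 \<le> n"
    and "0 < B"
    and "\<And>k. k \<in> {1..n} \<Longrightarrow> Polish_space (S k)"
    and "\<And>k. k \<in> {1..n} \<Longrightarrow> Z k \<in> measurable M (borel_of (S k))"
    and "\<And>g k. g \<in> G \<Longrightarrow> k \<in> {1..n} \<Longrightarrow> g k \<in> borel_measurable (borel_of (S k))"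
    and "(SUP g\<in>G. SUP k\<in>{1..n}. esssup M (\<lambda>\<omega>. ereal \<bar>g k (Z k \<omega>)\<bar>)) \<le> B"
    and "\<And>J. J \<subseteq> {1..n} \<Longrightarrow> J \<noteq> {} \<Longrightarrow> measurable_sup M S Z G a b J"
    and "B < \<infinity> \<Longrightarrow> separable_sup M S Z G a b {1..n}"
    and "\<And>k s. k \<in> {1..n} \<Longrightarrow> 0 \<le> s \<Longrightarrow> 0 \<le> L k s"
    and "\<And>(s::real) J. 0 \<le> s \<Longrightarrow> J \<subseteq> {1..n} \<Longrightarrow> J \<noteq> {} \<Longrightarrow>
           \<exists>(M' :: 'v measure) Z'.
             prob_space M' \<and>
             prob_space.indep_vars M' (\<lambda>j. borel_of (S j)) Z' J \<and>
             (\<forall>j\<in>J. distr M' (borel_of (S j)) (Z' j) = distr M (borel_of (S j)) (Z j)) \<and>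
             measure M' {\<omega> \<in> space M'.
                 ereal s \<le> (SUP g\<in>coord_proj J G. ereal (a * emp_mean J Z' g \<omega> + b * pop_mean M S J Z g))}
               \<le> L (card J) (ereal s)"
    and "m \<in> {1..n}"
    and "q = n div m" and "n = q * m + r" and "r < m"
    and "0 \<le> t"
  shows "let L' = L(n + 1 := L n);
             bd = of_bool (ereal t \<le> ereal (\<bar>a\<bar> + \<bar>b\<bar>) * B) :: ennreal;
             mid = (ennreal (real r * L' (q + 1) (ereal t) + (real m - real r) * L' q (ereal t))
                    + of_nat n * beta_coeff M S {1..n} Z m) * bd
         in emeasure M {\<omega> \<in> space M.
                ereal t \<le> (SUP g\<in>G. ereal (a * emp_mean {1..n} Z g \<omega> + b * pop_mean M S {1..n} Z g))}
              \<le> mid \<and>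
            mid \<le> (ennreal (real m * max (L' (q + 1) (ereal t)) (L' q (ereal t)))
                    + of_nat n * beta_coeff M S {1..n} Z m) * bd"
proof -
  interpret prob_space M by fact
  note Z = assms(5) and G_meas = assms(6) and L_nonneg = assms(10) and coupling = assms(11)
  have m: "0 < m" "m \<le> n"
    using assms(12) by auto
  have nq: "n = q * m + r" "r < m"
    by fact+
  define J where "J i = {j \<in> {1..n}. (j - 1) mod m = i}" for i
  define \<beta> where "\<beta> = beta_coeff M S {1..n} Z m"
  define D where "D K = {\<omega> \<in> space M. ereal t \<le>
      (SUP g\<in>G. ereal (a * emp_mean K Z g \<omega> + b * pop_mean M S K Z g))}" for K
  have q: "1 \<le> q"
    using assms(13) m by (simp add: Suc_le_eq div_greater_zero_iff)
  have card_J: "card (J i) = q + of_bool (i < r)" if "i < m" for i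
    unfolding J_def by (rule card_residue_class[OF nq that])
  have J: "J i \<subseteq> {1..n}" "finite (J i)" "J i \<noteq> {}" "card (J i) \<in> {1..n}" if "i < m" for i
  proof -
    show sub: "J i \<subseteq> {1..n}"
      by (auto simp: J_def)
    then show "finite (J i)"
      by (rule finite_subset) simp
    have c: "1 \<le> card (J i)"
      using card_J[OF that] q by simp
    then show "J i \<noteq> {}"
      by auto
    show "card (J i) \<in> {1..n}"
      using c card_mono[OF _ sub] by simp
  qed
  have J_UN: "(\<Union>i<m. J i) = {1..n}"
    using m by (auto simp: J_def)
  have J_disj: "disjoint_family_on J {..<m}"
    by (auto simp: disjoint_family_on_def J_def)
  have card_sum: "(\<Sum>i<m. card (J i)) = n"
    using card_UN_disjoint'[OF J_disj] J J_UN by simp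
  have gap: "i + m \<le> j" if ij: "i \<in> J k" "j \<in> J k" "i < j" for i j k
  proof -
    have i: "1 \<le> i"
      using ij by (simp add: J_def)
    with ij have "i - 1 + m \<le> j - 1"
      by (intro mod_eq_imp_add_le) (auto simp: J_def)
    with i show ?thesis
      using ij(3) by linarith
  qed
  have D_J: "D (J i) \<in> sets M" "emeasure M (D (J i)) \<le> ennreal (L (card (J i)) (ereal t)) + of_nat (card (J i)) * \<beta>"
    if i: "i < m" for i
  proof -
    note ms = assms(8)[OF J(1,3)[OF i]]
    have ZJ: "\<And>j. j \<in> J i \<Longrightarrow> Z j \<in> measurable M (borel_of (S j))"
      using Z J(1)[OF i] by auto
    show "D (J i) \<in> sets M"
      using measurable_sup_event(2)[OF ms ZJ, where t = t] by (simp add: D_def SUP_coord_proj)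
    obtain M' :: "'v measure" and Z' where M': "prob_space M'"
      "prob_space.indep_vars M' (\<lambda>j. borel_of (S j)) Z' (J i)"
      "\<forall>j\<in>J i. distr M' (borel_of (S j)) (Z' j) = distr M (borel_of (S j)) (Z j)"
      and le: "measure M' {\<omega> \<in> space M'. ereal t \<le>
         (SUP g\<in>coord_proj (J i) G. ereal (a * emp_mean (J i) Z' g \<omega> + b * pop_mean M S (J i) Z g))}
         \<le> L (card (J i)) (ereal t)"
      using coupling[OF \<open>0 \<le> t\<close> J(1,3)[OF i]] by blast
    interpret M': prob_space M' by fact
    have "emeasure M (D (J i)) \<le> emeasure M' {\<omega> \<in> space M'. ereal t \<le>
        (SUP g\<in>coord_proj (J i) G. ereal (a * emp_mean (J i) Z' g \<omega> + b * pop_mean M S (J i) Z g))} +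
        of_nat (card (J i)) * \<beta>"
      using emeasure_block_sup_le[OF \<open>prob_space M\<close> Z _ m(1) J(2,3,1)[OF i] gap ms M'(1,2), where t = t] M'(3)
      by (simp add: D_def \<beta>_def SUP_coord_proj)
    also have "\<dots> \<le> ennreal (L (card (J i)) (ereal t)) + of_nat (card (J i)) * \<beta>"
      using le by (intro add_right_mono) (simp add: M'.emeasure_eq_measure ennreal_leI)
    finally show "emeasure M (D (J i)) \<le> ennreal (L (card (J i)) (ereal t)) + of_nat (card (J i)) * \<beta>" .
  qed
  have D_sub: "D {1..n} \<subseteq> (\<Union>i<m. D (J i))"
  proof
    fix \<omega> assume \<omega>: "\<omega> \<in> D {1..n}"
    let ?d = "\<lambda>i g. a * emp_mean (J i) Z g \<omega> + b * pop_mean M S (J i) Z g"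
    \<comment> \<open>Empirical and population means decompose with the same weights
      \<open>card (J i) / n\<close>, hence so does their combination with \<open>a\<close> and
      \<open>b\<close>.\<close>
    have "a * emp_mean {1..n} Z g \<omega> + b * pop_mean M S {1..n} Z g =
        (\<Sum>i<m. real (card (J i)) / real n * ?d i g)" for g
    proof -
      have avg: "(\<Sum>j\<in>{1..n}. f j) / real n =
          (\<Sum>i<m. real (card (J i)) / real n * ((\<Sum>j\<in>J i. f j) / real (card (J i))))" for f :: "nat \<Rightarrow> real"
        using average_UN_disjoint[of "{..<m}" J f "real n"] J J_disj by (simp add: J_UN)
      show ?thesis
        unfolding emp_mean_def pop_mean_def card_atLeastAtMost diff_Suc_1 avg
        by (simp add: avg sum_distrib_left sum.distrib distrib_left mult_ac)
    qed
    then have "ereal t \<le> (SUP g\<in>G. ereal (\<Sum>i<m. real (card (J i)) / real n * ?d i g))"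
      using \<omega> by (simp add: D_def)
    moreover have "(\<Sum>i<m. real (card (J i)) / real n) = 1"
      using card_sum assms(2) by (simp flip: sum_divide_distrib of_nat_sum)
    ultimately obtain i where "i < m" "ereal t \<le> (SUP g\<in>G. ereal (?d i g))"
      using le_SUP_convex_combination[where I = "{..<m}" and w = "\<lambda>i. real (card (J i)) / real n" and t = t and G = G and d = ?d] by auto
    with \<omega> show "\<omega> \<in> (\<Union>i<m. D (J i))"
      by (auto simp: D_def)
  qed
  \<comment> \<open>The value at \<open>n + 1\<close> is consulted only if \<open>m = 1\<close>.
    Then \<open>q = n\<close> and \<open>r = 0\<close>: no class has size \<open>q + 1\<close>, and
    the factor \<open>r\<close> removes that term from the middle bound.\<close>
  define L' where "L' = L(n + 1 := L n)"
  define x where "x = L' (q + 1) (ereal t)"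
  define y where "y = L' q (ereal t)"
  define bd where "bd = (of_bool (ereal t \<le> ereal (\<bar>a\<bar> + \<bar>b\<bar>) * B) :: ennreal)"
  have L_sum: "(\<Sum>i<m. ennreal (L (card (J i)) (ereal t))) = ennreal (real r * x + (real m - real r) * y)"
  proof -
    have "L (card (J i)) (ereal t) = (if i < r then x else y)" if "i < m" for i
      using card_J[OF that] J(4)[OF that] by (auto simp: L'_def x_def y_def)
    then have "(\<Sum>i<m. L (card (J i)) (ereal t)) = (\<Sum>i<m. if i < r then x else y)"
      by (intro sum.cong) auto
    also have "\<dots> = real r * x + (real m - real r) * y"
    proof -
      have "{..<m} \<inter> {i. i < r} = {..<r}" "{..<m} \<inter> - {i. i < r} = {r..<m}"
        using nq by auto
      then show ?thesis
        using nq by (simp add: sum.If_cases of_nat_diff)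
    qed
    finally show ?thesis
      using L_nonneg J(4) \<open>0 \<le> t\<close> by (subst sum_ennreal) auto
  qed
  have le_sum: "emeasure M (D {1..n}) \<le> ennreal (real r * x + (real m - real r) * y) + of_nat n * \<beta>"
  proof -
    have "emeasure M (D {1..n}) \<le> emeasure M (\<Union>i<m. D (J i))"
      using D_sub D_J by (intro emeasure_mono) auto
    also have "\<dots> \<le> (\<Sum>i<m. emeasure M (D (J i)))"
      using D_J by (intro emeasure_subadditive_finite) auto
    also have "\<dots> \<le> (\<Sum>i<m. ennreal (L (card (J i)) (ereal t)) + of_nat (card (J i)) * \<beta>)"
      using D_J by (intro sum_mono) auto
    also have "\<dots> = ennreal (real r * x + (real m - real r) * y) + of_nat n * \<beta>"
      unfolding sum.distrib L_sum card_sum[symmetric] of_nat_sum sum_distrib_right ..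
    finally show ?thesis .
  qed
  \<comment> \<open>Where the indicator is 0, the first inequality says that the event is
    null.\<close>
  have null: "emeasure M (D {1..n}) = 0" if t_gt: "\<not> ereal t \<le> ereal (\<bar>a\<bar> + \<bar>b\<bar>) * B"
  proof (cases B)
    case (real B')
    have "AE \<omega> in M. \<bar>g k (Z k \<omega>)\<bar> \<le> B'" if "g \<in> G" "k \<in> {1..n}" for g k
    proof -
      have "esssup M (\<lambda>\<omega>. ereal \<bar>g k (Z k \<omega>)\<bar>) \<le>
          (SUP g\<in>G. SUP k\<in>{1..n}. esssup M (\<lambda>\<omega>. ereal \<bar>g k (Z k \<omega>)\<bar>))"
        by (rule SUP_upper2[OF that(1) SUP_upper[OF that(2)]])
      also have "\<dots> \<le> ereal B'"
        using assms(7) real by simp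
      finally have le: "esssup M (\<lambda>\<omega>. ereal \<bar>g k (Z k \<omega>)\<bar>) \<le> ereal B'" .
      show ?thesis
        using esssup_AE[of "\<lambda>\<omega>. ereal \<bar>g k (Z k \<omega>)\<bar>" M]
      proof eventually_elim
        case (elim \<omega>)
        from order_trans[OF elim le] show ?case
          by simp
      qed
    qed
    then have "AE \<omega> in M. (SUP g\<in>G. ereal (a * emp_mean {1..n} Z g \<omega> + b * pop_mean M S {1..n} Z g)) \<le>
        ereal ((\<bar>a\<bar> + \<bar>b\<bar>) * B')"
      using assms(2,9) Z G_meas real by (intro AE_sup_le_bound[OF \<open>prob_space M\<close>]) auto
    then have "AE \<omega> in M. \<not> ereal t \<le>
        (SUP g\<in>G. ereal (a * emp_mean {1..n} Z g \<omega> + b * pop_mean M S {1..n} Z g))"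
    proof eventually_elim
      case (elim \<omega>)
      show ?case
        using t_gt real order_trans[OF _ elim, of "ereal t"] by auto
    qed
    then show ?thesis
      unfolding D_def by (rule emeasure_eq_0_AE)
  next
    case PInf
    \<comment> \<open>With infinite \<open>B\<close> the threshold is infinite unless
      \<open>a\<close> and \<open>b\<close> vanish; then it is 0, as 0 times infinity is 0 in
      \<open>ereal\<close>. What remains is \<open>t > 0\<close> against a supremum of
      zeros.\<close>
    have "\<bar>a\<bar> + \<bar>b\<bar> = 0"
    proof (rule ccontr)
      assume "\<bar>a\<bar> + \<bar>b\<bar> \<noteq> 0"
      then have "0 < \<bar>a\<bar> + \<bar>b\<bar>"
        by linarith
      with t_gt PInf show False
        by simp
    qed
    then have ab: "a = 0" "b = 0"
      by linarith+
    have "0 < t"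
      using ab t_gt PInf by (simp add: linorder_not_le zero_ereal_def[symmetric])
    have "(SUP g\<in>G. ereal (a * emp_mean {1..n} Z g \<omega> + b * pop_mean M S {1..n} Z g)) < ereal t" for \<omega>
    proof -
      have "(SUP g\<in>G. ereal (a * emp_mean {1..n} Z g \<omega> + b * pop_mean M S {1..n} Z g)) \<le> ereal 0"
        using ab by (intro SUP_least) simp
      also have "\<dots> < ereal t"
        using \<open>0 < t\<close> by simp
      finally show ?thesis .
    qed
    then have "D {1..n} = {}"
      unfolding D_def by (auto simp: linorder_not_le[symmetric])
    then show ?thesis
      by simp
  next
    case MInf
    with assms(3) show ?thesis
      by simp
  qed
  have "emeasure M (D {1..n}) \<le> (ennreal (real r * x + (real m - real r) * y) + of_nat n * \<beta>) * bd"
    using le_sum null by (cases "ereal t \<le> ereal (\<bar>a\<bar> + \<bar>b\<bar>) * B") (auto simp: bd_def)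
  moreover have "real r * x + (real m - real r) * y \<le> real m * max x y"
  proof -
    have "real r * x + (real m - real r) * y \<le> real r * max x y + (real m - real r) * max x y"
      using nq by (intro add_mono mult_left_mono) auto
    then show ?thesis
      by (simp add: algebra_simps)
  qed
  then have "(ennreal (real r * x + (real m - real r) * y) + of_nat n * \<beta>) * bd \<le>
      (ennreal (real m * max x y) + of_nat n * \<beta>) * bd"
    by (intro mult_right_mono add_right_mono ennreal_leI) auto
  ultimately show ?thesis
    unfolding Let_def D_def \<beta>_def bd_def x_def y_def L'_def by blast
qed

end
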